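(* Let $x\in C^J$ with $x(0)\in\mathbb{R}_+^J$, and let $z=\Gamma(x)$ and $y=\Phi(x)$ be given by the oblique reflection map associated with $R$. Define the derivatives $a=\Gamma'(x)$ and $b=-\Phi'(x)$, and set $\chi(t)=tE$ for $t\ge 0$. Then $(z,y,a,b)$ satisfies the augmented Skorohod problem associated with $(R,R)$ for $(x,\chi)$.
   Context: Fix $J\in\mathbb{N}$. $E$ is the $J\times J$ identity matrix; for a matrix $M$, $M^j$ is its $j$th column and $M_i$ its $i$th row. $\mathbb{M}^{J\times J}$ is the space of real $J\times J$ matrices, $\mathbb{M}_+^{J\times J}$ the subset of entrywise nonnegative ones. $C^J$ (resp. $C^J_+$) is the space of continuous functions from $\mathbb{R}_+=[0,\infty)$ to $\mathbb{R}^J$ (resp. $\mathbb{R}_+^J$); $C^{J\times J}$ is the space of continuous $\mathbb{M}^{J\times J}$-valued functions on $\mathbb{R}_+$. $\mathbb{D}^J,\mathbb{D}^J_+,\mathbb{D}^{J\times J},\mathbb{D}_+^{J\times J}$ are the spaces of right-continuous functions on $\mathbb{R}_+$ with left limits on $(0,\infty)$, with values in $\mathbb{R}^J,\mathbb{R}^J_+,\mathbb{M}^{J\times J},\mathbb{M}^{J\times J}_+$ respectively. For vector-valued functions, $\int v(t)\,dw(t)=\sum_i\int v_i(t)\,dw_i(t)$. The matrix $R=E-P$, where $P$ is a nonnegative $J\times J$ matrix with spectral radius less than one and zeros on the diagonal. Oblique reflection map: for every $x\in\mathbb{D}^J$ with $x(0)\in\mathbb{R}_+^J$ there is a unique pair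 $(y,z)\in\mathbb{D}_+^J\times\mathbb{D}_+^J$ such that (1) $z(t)=x(t)+Ry(t)\ge 0$ for $t\ge0$; (2) $y(0)=0$, $y$ is componentwise nondecreasing and $\int_0^\infty z(t)\,dy(t)=0$. One writes $y=\Phi(x)$, $z=\Gamma(x)$. Derivatives: with $\chi(t)=tE$, for $\epsilon>0$ and $j=1,\dots,J$ let $a_\epsilon^j=\frac1\epsilon[\Gamma(x)-\Gamma(x-\epsilon\chi^j)]$ and $b_\epsilon^j=-\frac1\epsilon[\Phi(x)-\Phi(x-\epsilon\chi^j)]$ be the columns of $a_\epsilon,b_\epsilon$. The pointwise limits $a=\lim_{\epsilon\to0+}a_\epsilon$ and $b=\lim_{\epsilon\to0+}b_\epsilon$ are known to exist; write $a=\Gamma'(x)$ and $b=-\Phi'(x)$. They satisfy $a(t)=tE-Rb(t)$. Augmented Skorohod problem: let $R=E-P$ and $\widetilde R=E-\widetilde P$, where $P,\widetilde P$ are nonnegative $J\times J$ matrices with spectral radius less than one and zero diagonal. Given $(x,\chi)\in C^J\times C^{J\times J}$ with $\chi$ componentwise nonnegative and nondecreasing, $(z,y,a,b)\in C_+^J\times C_+^J\times\mathbb{D}_+^{J\times J}\times\mathbb{D}_+^{J\times J}$ satisfies the augmented Skorohod problem associated with $(R,\widetilde R)$ for $(x,\chi)$ if: (1) $z(t)=x(t)+Ry(t)$ for $t\ge0$; (2) $y(0)=0$, $y$ is componentwise nondecreasing and $\int_0^\infty z(t)\,dy(t)=0$; (3) $a(t)=\chi(t)-\widetilde R\,b(t)$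 for $t\ge0$; (4) $b(0)=0$, $b(t)\ge0$, $b$ is componentwise nondecreasing and $\int_0^\infty z(t)\,db^j(t)=0$ for $j=1,\dots,J$; (5) for $i=1,\dots,J$ and $t\ge0$, $z_i(t)=0$ implies $a_i(t)=0$ (the $i$th row of $a(t)$ vanishes). *)

theory Defs
  imports "HOL-Analysis.Analysis"
begin

text \<open>
  Paths indexed by $[0,\infty)$ are functions of type \<open>real \<Rightarrow> _\<close>; their values at negative
  times carry no meaning. The order on vectors and matrices is the componentwise one of
  the library. For a matrix \<open>M\<close>, \<open>M $ i\<close> is the \<open>i\<close>-th row and \<open>column j M\<close> the \<open>j\<close>-th column.
\<close>

definition matrix_spectral_radius :: "real^'n^'n \<Rightarrow> real" where
  "matrix_spectral_radius P =
     Max (cmod ` {l :: complex. \<exists>v :: complex^'n. v \<noteq> 0 \<and> map_matrix complex_of_real P *v v = l *s v})"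

definition reflection_matrix :: "real^'n^'n \<Rightarrow> bool" where
  "reflection_matrix R \<longleftrightarrow>
     (\<exists>P. R = mat 1 - P \<and> 0 \<le> P \<and> matrix_spectral_radius P < 1 \<and> (\<forall>i. P $ i $ i = 0))"

definition cadlag :: "(real \<Rightarrow> 'a::topological_space) \<Rightarrow> bool" where
  "cadlag f \<longleftrightarrow> (\<forall>t\<ge>0. (f \<longlongrightarrow> f t) (at_right t)) \<and> (\<forall>t>0. \<exists>l. (f \<longlongrightarrow> l) (at_left t))"

text \<open>
  Lebesgue--Stieltjes integral $\sum_i \int_0^\infty v_i \, dw_i$ of a nonnegative path \<open>v\<close> against a
  nondecreasing right-continuous path \<open>w\<close>. Extending \<open>w\<close> constantly to negative times gives no mass
  to the point 0, in agreement with the condition $w(0) = 0$ imposed wherever this is used.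
  The nonnegative integral is used so that a divergent integral has the value \<open>\<infinity>\<close> and not \<open>0\<close>.
\<close>
definition stieltjes :: "(real \<Rightarrow> real^'n) \<Rightarrow> (real \<Rightarrow> real^'n) \<Rightarrow> ennreal" where
  "stieltjes v w =
     (\<Sum>i\<in>UNIV. \<integral>\<^sup>+t\<in>{0..}. ennreal (v t $ i) \<partial>interval_measure (\<lambda>s. w (max s 0) $ i))"

definition oblique_reflection ::
    "real^'n^'n \<Rightarrow> (real \<Rightarrow> real^'n) \<Rightarrow> (real \<Rightarrow> real^'n) \<Rightarrow> (real \<Rightarrow> real^'n) \<Rightarrow> bool" where
  "oblique_reflection R x y z \<longleftrightarrow>
     cadlag y \<and> (\<forall>t\<ge>0. 0 \<le> y t) \<and> cadlag z \<and> (\<forall>t\<ge>0. 0 \<le> z t) \<and>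
     (\<forall>t\<ge>0. z t = x t + R *v y t) \<and>
     y 0 = 0 \<and> mono_on {0..} y \<and> stieltjes z y = 0"

text \<open>
  The pair \<open>(y, z)\<close> is unique only as a pair of functions on $[0,\infty)$; \<open>extensional\<close> fixes the
  irrelevant values at negative times.
\<close>
definition reflection_pair ::
    "real^'n^'n \<Rightarrow> (real \<Rightarrow> real^'n) \<Rightarrow> (real \<Rightarrow> real^'n) \<times> (real \<Rightarrow> real^'n)" where
  "reflection_pair R x =
     (THE (y, z). y \<in> extensional {0..} \<and> z \<in> extensional {0..} \<and> oblique_reflection R x y z)"

definition refl_Phi :: "real^'n^'n \<Rightarrow> (real \<Rightarrow> real^'n) \<Rightarrow> real \<Rightarrow> real^'n" where
  "refl_Phi R x = fst (reflection_pair R x)"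

definition refl_Gamma :: "real^'n^'n \<Rightarrow> (real \<Rightarrow> real^'n) \<Rightarrow> real \<Rightarrow> real^'n" where
  "refl_Gamma R x = snd (reflection_pair R x)"

definition drift :: "real \<Rightarrow> real^'n^'n" where
  "drift t = t *\<^sub>R mat 1"

text \<open>
  The matrix-valued path whose \<open>j\<close>-th column is the pointwise limit of
  $\epsilon^{-1} [F(x) - F(x - \epsilon \chi^j)]$ as $\epsilon \downarrow 0$, where $\chi$ is \<open>drift\<close>.
\<close>
definition path_deriv ::
    "((real \<Rightarrow> real^'n) \<Rightarrow> real \<Rightarrow> real^'n) \<Rightarrow> (real \<Rightarrow> real^'n) \<Rightarrow> real \<Rightarrow> real^'n^'n" where
  "path_deriv F x t =
     Lim (at_right 0)
       (\<lambda>\<epsilon>. \<chi> i j. ((1 / \<epsilon>) *\<^sub>R (F x t - F (\<lambda>s. x s - \<epsilon> *\<^sub>R column j (drift s)) t)) $ i)"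

text \<open>
  The requirements on the data \<open>R\<close>, \<open>R'\<close>, \<open>x\<close> and \<open>X\<close> are part of the predicate.
\<close>
definition augmented_skorohod ::
    "real^'n^'n \<Rightarrow> real^'n^'n \<Rightarrow> (real \<Rightarrow> real^'n) \<Rightarrow> (real \<Rightarrow> real^'n^'n) \<Rightarrow>
     (real \<Rightarrow> real^'n) \<Rightarrow> (real \<Rightarrow> real^'n) \<Rightarrow> (real \<Rightarrow> real^'n^'n) \<Rightarrow> (real \<Rightarrow> real^'n^'n) \<Rightarrow> bool" where
  "augmented_skorohod R R' x X z y a b \<longleftrightarrow>
     reflection_matrix R \<and> reflection_matrix R' \<and> continuous_on {0..} x \<and>
     continuous_on {0..} X \<and> (\<forall>t\<ge>0. 0 \<le> X t) \<and> mono_on {0..} X \<and>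
     continuous_on {0..} z \<and> (\<forall>t\<ge>0. 0 \<le> z t) \<and>
     continuous_on {0..} y \<and> (\<forall>t\<ge>0. 0 \<le> y t) \<and>
     cadlag a \<and> (\<forall>t\<ge>0. 0 \<le> a t) \<and>
     cadlag b \<and> (\<forall>t\<ge>0. 0 \<le> b t) \<and>
     (\<forall>t\<ge>0. z t = x t + R *v y t) \<and>
     y 0 = 0 \<and> mono_on {0..} y \<and> stieltjes z y = 0 \<and>
     (\<forall>t\<ge>0. a t = X t - R' ** b t) \<and>
     b 0 = 0 \<and> mono_on {0..} b \<and> (\<forall>j. stieltjes z (\<lambda>t. column j (b t)) = 0) \<and>
     (\<forall>i. \<forall>t\<ge>0. z t $ i = 0 \<longrightarrow> a t $ i = 0)"

end

theory Submission
  imports Defs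
begin

text \<open>
  The reflection of a continuous path \<open>x\<close> is obtained from the one-dimensional formula
  $y(t) = \sup_{s \le t} \max(0, -w(s))$: the pushing path is the fixed point of
  $y_i(t) = \sup_{s \le t} \max(0, -x_i(s) + (P y)_i(s))$. Since \<open>P\<close> is nonnegative of spectral radius less
  than one, some positive vector \<open>u\<close> satisfies $P u \le \rho u$ with $\rho < 1$
  (\<open>positive_vector_contracted\<close>), so the fixed-point map contracts in the sup norm weighted by \<open>u\<close>.
  This gives existence by iteration, and uniqueness among right-continuous paths because
  complementarity forces every solution below the one-dimensional supremum
  (\<open>complementary_path_minimal\<close>).

  The iteration also transports order properties from dimension one to the fixed point, and two of
  them determine the derivative. The fixed point \<open>y\<close> is sublinear in $-x$
  (\<open>oblique_regulator_sublinear\<close>), hence the difference quotients of $y^\epsilon$, the pushing path of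
  $x - \epsilon \chi^j$, decrease to their infimum as $\epsilon$ decreases to 0. And subtracting a
  nondecreasing path from \<open>x\<close> makes $y^\epsilon - y$ nondecreasing in time while the reflected path
  does not grow (\<open>oblique_regulator_comparison\<close>).

  So $b^j$ is an infimum of continuous nondecreasing paths: it is nondecreasing and upper
  semicontinuous, hence right-continuous. From $z^\epsilon \le z$ one gets $a \ge 0$, and where $z_i = 0$ the
  bounds $0 \le z^\epsilon_i \le z_i$ force the row $a_i$ to vanish. On a compact interval where $z_i > 0$
  the path $z^\epsilon_i$ is positive too for small $\epsilon$, because $z - z^\epsilon$ is of order
  $\epsilon$; neither $y_i$ nor $y^\epsilon_i$ moves there, hence $b_i$ is constant on it. Countably
  many such intervals cover the set where $z_i > 0$, so $\int z \, db^j = 0$.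
\<close>

section \<open>A positive vector contracted by the routing matrix\<close>

text \<open>
  The maximum in \<open>matrix_spectral_radius\<close> bounds the eigenvalues only if there are finitely many of
  them. They are the roots of the characteristic polynomial, a determinant over the polynomial ring.
\<close>
lemma finite_matrix_eigenvalues:
  fixes A :: "complex^'n^'n"
  shows "finite {l. \<exists>v. v \<noteq> 0 \<and> A *v v = l *s v}"
proof -
  define p where "p = det (\<chi> i j. [: - A $ i $ j, if i = j then 1 else 0 :] :: complex poly^'n^'n)"
  have poly_p: "poly p l = det (mat l - A)" for l
  proof -
    have "poly p l = (\<Sum>f\<in>{f. f permutes (UNIV::'n set)}. of_int (sign f) *
        (\<Prod>i\<in>UNIV. - A $ i $ f i + l * (if i = f i then 1 else 0)))"
      by (simp add: p_def det_def poly_sum poly_prod)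
    also have "\<dots> = det (mat l - A)"
      unfolding det_def
      by (intro sum.cong refl arg_cong2[where f = "(*)"] prod.cong) (auto simp: mat_def)
    finally show ?thesis .
  qed
  have mat_v: "(mat l - A) *v v = l *s v - A *v v" for l v
  proof -
    have "mat l *v v = l *s v"
      by (simp add: vec_eq_iff matrix_vector_mult_def mat_def if_distrib if_distribR cong: if_cong)
    then show ?thesis
      by (simp add: matrix_vector_mult_diff_rdistrib)
  qed
  have root_iff: "poly p l = 0 \<longleftrightarrow> (\<exists>v. v \<noteq> 0 \<and> A *v v = l *s v)" for l
  proof -
    have "poly p l \<noteq> 0 \<longleftrightarrow> (\<forall>v. (mat l - A) *v v = 0 \<longrightarrow> v = 0)"
      by (simp add: poly_p invertible_det_nz[symmetric] invertible_left_inverse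
          matrix_left_invertible_ker)
    then show ?thesis
      by (auto simp: mat_v)
  qed
  \<comment> \<open>Otherwise every number would be an eigenvalue, including one above the operator bound of \<open>A\<close>.\<close>
  have "p \<noteq> 0"
  proof
    assume "p = 0"
    have "linear ((*v) A)"
      by (rule linearI) (simp_all add: matrix_vector_mult_def vec_eq_iff scaleR_sum_right
          distrib_left sum.distrib)
    then obtain K where K: "\<And>v. norm (A *v v) \<le> K * norm v" "K > 0"
      using linear_bounded_pos by blast
    from \<open>p = 0\<close> obtain v where v: "v \<noteq> 0" "A *v v = of_real (K + 1) *s v"
      using root_iff[of "of_real (K + 1)"] by auto
    have "norm (of_real (K + 1) *s v) = norm ((K + 1) *\<^sub>R v)"
      by (rule arg_cong[where f = norm]) (simp add: vec_eq_iff, simp add: scaleR_conv_of_real algebra_simps)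
    then have "(K + 1) * norm v \<le> K * norm v"
      using K v by (metis abs_of_pos add_pos_pos norm_scaleR zero_less_one)
    then show False using v by (simp add: algebra_simps)
  qed
  then have "finite {l. poly p l = 0}" by (rule poly_roots_finite)
  then show ?thesis by (simp add: root_iff)
qed

lemma real_eigenvalue_le_spectral_radius:
  fixes P :: "real^'n^'n"
  assumes "v \<noteq> 0" "P *v v = l *s v"
  shows "\<bar>l\<bar> \<le> matrix_spectral_radius P"
proof -
  let ?v = "\<chi> i. complex_of_real (v $ i)"
  have "?v \<noteq> 0" using assms(1) by (auto simp: vec_eq_iff)
  moreover have "map_matrix complex_of_real P *v ?v = complex_of_real l *s ?v"
    using assms(2)
    by (auto simp: vec_eq_iff map_matrix_def matrix_vector_mult_def
        simp flip: of_real_mult of_real_sum)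
  ultimately have "cmod (complex_of_real l) \<le> matrix_spectral_radius P"
    unfolding matrix_spectral_radius_def
    by (intro Max_ge finite_imageI finite_matrix_eigenvalues imageI) blast
  then show ?thesis by simp
qed

text \<open>
  As no real eigenvalue reaches 1, the system
  $u = 1 + s P u$ has a unique solution $u(s)$ for every $0 \le s \le 1$, continuous in \<open>s\<close> by Cramer's
  rule. A nonnegative solution is automatically at least 1 in every component, so along the
  connected interval from $u(0) = 1$ to $u(1)$ nonnegativity cannot be lost. Then $P u(1) = u(1) - 1 < u(1)$.
\<close>
lemma positive_vector_contracted:
  fixes P :: "real^'n^'n"
  assumes P: "\<And>i j. 0 \<le> P $ i $ j" and "matrix_spectral_radius P < 1"
  obtains u :: "real^'n" and \<rho> :: real
  where "\<And>i. 0 < u $ i" "0 \<le> \<rho>" "\<rho> < 1" "\<And>i. (P *v u) $ i \<le> \<rho> * u $ i"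
proof -
  define A where "A s = mat 1 - s *\<^sub>R P" for s
  have A_v: "A s *v v = v - s *\<^sub>R (P *v v)" for s v
    by (simp add: A_def matrix_vector_mult_diff_rdistrib scaleR_matrix_vector_assoc)
  have det_A: "det (A s) \<noteq> 0" if "0 \<le> s" "s \<le> 1" for s
  proof -
    have "v = 0" if "A s *v v = 0" for v
    proof (rule ccontr)
      assume "v \<noteq> 0"
      from that have *: "v = s *\<^sub>R (P *v v)" by (simp add: A_v)
      with \<open>v \<noteq> 0\<close> have "s \<noteq> 0" by auto
      with \<open>0 \<le> s\<close> have "s > 0" by simp
      have "(1/s) *\<^sub>R v = (1/s) *\<^sub>R (s *\<^sub>R (P *v v))" using * by simp
      then have "P *v v = (1/s) *s v" using \<open>s > 0\<close> by (simp add: scalar_mult_eq_scaleR)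
      from real_eigenvalue_le_spectral_radius[OF \<open>v \<noteq> 0\<close> this] \<open>s > 0\<close> \<open>s \<le> 1\<close>
      have "1 \<le> matrix_spectral_radius P" by (simp add: order_trans[of 1 "1/s"])
      with assms(2) show False by simp
    qed
    then show ?thesis
      by (simp add: invertible_det_nz[symmetric] invertible_left_inverse matrix_left_invertible_ker)
  qed
  define u :: "real \<Rightarrow> real^'n" where
    "u s = (\<chi> k. det (\<chi> i j. if j = k then (1 :: real^'n) $ i else A s $ i $ j) / det (A s))" for s
  have u_eq: "u s $ i = 1 + s * (P *v u s) $ i" if "0 \<le> s" "s \<le> 1" for s i
  proof -
    have "A s *v u s = 1"
      using cramer[OF det_A[OF that], of "u s" 1] by (simp add: u_def)
    then have "(u s - s *\<^sub>R (P *v u s)) $ i = 1 $ i" by (simp add: A_v)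
    then show ?thesis by simp
  qed
  have cont: "continuous_on {0..1} (\<lambda>s. u s $ k)" for k
  proof -
    have "continuous_on {0..1} (\<lambda>s. det (\<chi> i j. if j = k then (1 :: real^'n) $ i else A s $ i $ j))"
    proof -
      have "continuous_on {0..1} (\<lambda>s. if j = k then (1 :: real^'n) $ i else A s $ i $ j)" for i j
        unfolding A_def by (cases "j = k") (auto intro!: continuous_intros)
      then show ?thesis
        unfolding det_def by (auto intro!: continuous_intros)
    qed
    moreover have "continuous_on {0..1} (\<lambda>s. det (A s))"
      unfolding det_def A_def by (auto intro!: continuous_intros)
    ultimately show ?thesis
      unfolding u_def using det_A by (auto intro!: continuous_on_divide)
  qed
  have P_nonneg: "0 \<le> (P *v v) $ i" if "\<And>j. 0 \<le> v $ j" for v i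
    unfolding matrix_vector_mult_def using P that by (auto intro!: sum_nonneg)
  have gap: "1 \<le> u s $ k" if "0 \<le> s" "s \<le> 1" "\<And>i. 0 \<le> u s $ i" for s k
    using u_eq[OF that(1,2)] P_nonneg[OF that(3)] that(1) by simp
  \<comment> \<open>The total deficit below 1 vanishes if \<open>u s\<close> is nonnegative and exceeds 1 otherwise, so by
    continuity it cannot leave its value 0 at \<open>s = 0\<close>.\<close>
  define g where "g s = (\<Sum>i\<in>UNIV. max 0 (1 - u s $ i))" for s
  have "g 1 < 1"
  proof (rule ccontr)
    assume "\<not> g 1 < 1"
    moreover have "g 0 = 0" using u_eq[of 0] by (simp add: g_def)
    moreover have "continuous_on {0..1} g"
      unfolding g_def by (intro continuous_intros cont)
    ultimately obtain s where s: "0 \<le> s" "s \<le> 1" "g s = 1"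
      using IVT'[of g 0 1 1] by auto
    have "0 \<le> u s $ i" for i
    proof -
      have "max 0 (1 - u s $ i) \<le> g s"
        unfolding g_def by (intro member_le_sum) auto
      then show ?thesis using s by simp
    qed
    then have "g s = 0" using gap[OF s(1,2)] by (auto simp: g_def intro!: sum.neutral)
    then show False using s by simp
  qed
  have u1: "0 \<le> u 1 $ i" for i
  proof -
    have "max 0 (1 - u 1 $ i) \<le> g 1"
      unfolding g_def by (intro member_le_sum) auto
    then show ?thesis using \<open>g 1 < 1\<close> by simp
  qed
  then have u1': "1 \<le> u 1 $ i" for i using gap[of 1] by simp
  define \<rho> where "\<rho> = Max (range (\<lambda>i. (P *v u 1) $ i / u 1 $ i))"
  have le: "(P *v u 1) $ i / u 1 $ i \<le> \<rho>" for i
    unfolding \<rho>_def by (rule Max_ge) auto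
  show thesis
  proof (rule that[of "u 1" \<rho>])
    show pos: "0 < u 1 $ i" for i using u1'[of i] by simp
    show "(P *v u 1) $ i \<le> \<rho> * u 1 $ i" for i
      using le[of i] pos[of i] by (simp add: field_simps)
    have "0 \<le> (P *v u 1) $ i / u 1 $ i" for i
      using P_nonneg[OF u1] pos[of i] by simp
    then show "0 \<le> \<rho>" using le order_trans by blast
    have "(P *v u 1) $ i / u 1 $ i < 1" for i
      using u_eq[of 1 i] pos[of i] by simp
    then show "\<rho> < 1" unfolding \<rho>_def by (subst Max_less_iff) auto
  qed
qed


section \<open>The one-dimensional regulator\<close>

text \<open>
  The smallest nonnegative nondecreasing path whose sum with \<open>w\<close> is nonnegative.
\<close>
definition regulator :: "(real \<Rightarrow> real) \<Rightarrow> real \<Rightarrow> real" where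
  "regulator w t = (SUP s\<in>{0..t}. max 0 (- w s))"

lemma regulator_attained:
  assumes w: "continuous_on {0..} w" and "0 \<le> t"
  obtains s where "0 \<le> s" "s \<le> t" "regulator w t = max 0 (- w s)"
    "\<And>r. 0 \<le> r \<Longrightarrow> r \<le> t \<Longrightarrow> max 0 (- w r) \<le> regulator w t"
proof -
  have "continuous_on {0..t} (\<lambda>s. max 0 (- w s))"
    by (intro continuous_intros continuous_on_subset[OF w]) auto
  then obtain s where s: "s \<in> {0..t}" "\<forall>r\<in>{0..t}. max 0 (- w r) \<le> max 0 (- w s)"
    using continuous_attains_sup[of "{0..t}" "\<lambda>s. max 0 (- w s)"] \<open>0 \<le> t\<close> by auto
  have "regulator w t = max 0 (- w s)"
    unfolding regulator_def using s by (intro cSup_eq_maximum) auto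
  with s show thesis by (intro that[of s]) auto
qed

lemma regulator_ge:
  assumes "continuous_on {0..} w" "0 \<le> s" "s \<le> t"
  shows "- w s \<le> regulator w t" and "0 \<le> regulator w t"
proof -
  obtain r where "\<And>r. 0 \<le> r \<Longrightarrow> r \<le> t \<Longrightarrow> max 0 (- w r) \<le> regulator w t"
    using regulator_attained[OF assms(1) order_trans[OF assms(2,3)]] by blast
  from this[OF assms(2,3)] show "- w s \<le> regulator w t" and "0 \<le> regulator w t" by simp_all
qed

lemma regulator_le:
  assumes "0 \<le> t" "0 \<le> c" "\<And>s. 0 \<le> s \<Longrightarrow> s \<le> t \<Longrightarrow> - w s \<le> c"
  shows "regulator w t \<le> c"
  unfolding regulator_def using assms by (intro cSUP_least) auto

lemma regulator_mono:
  assumes "continuous_on {0..} w" "0 \<le> s" "s \<le> t"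
  shows "regulator w s \<le> regulator w t"
  using assms by (intro regulator_le regulator_ge) auto

lemma regulator_zero:
  assumes "0 \<le> w 0"
  shows "regulator w 0 = 0"
  using assms by (simp add: regulator_def)

lemma regulator_lipschitz:
  assumes w: "continuous_on {0..} w" "continuous_on {0..} w'" and "0 \<le> t"
    and close: "\<And>s. 0 \<le> s \<Longrightarrow> s \<le> t \<Longrightarrow> \<bar>w s - w' s\<bar> \<le> d"
  shows "\<bar>regulator w t - regulator w' t\<bar> \<le> d"
proof -
  have "0 \<le> d" using close[of 0] \<open>0 \<le> t\<close> by simp
  have "regulator v t \<le> regulator v' t + d"
    if "continuous_on {0..} v'" "\<And>s. 0 \<le> s \<Longrightarrow> s \<le> t \<Longrightarrow> \<bar>v s - v' s\<bar> \<le> d" for v v'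
  proof (rule regulator_le)
    fix s assume "0 \<le> s" "s \<le> t"
    then show "- v s \<le> regulator v' t + d"
      using regulator_ge(1)[OF that(1), of s t] that(2)[of s] by linarith
  qed (use \<open>0 \<le> t\<close> \<open>0 \<le> d\<close> regulator_ge(2)[OF that(1), of 0 t] in auto)
  from this[of w' w] this[of w w'] have "regulator w t \<le> regulator w' t + d"
    "regulator w' t \<le> regulator w t + d"
    using w close by (simp_all add: abs_minus_commute)
  then show ?thesis by (simp add: abs_le_iff)
qed

text \<open>
  The regulator grows over an interval only by attaining its supremum at a time \<open>r\<close> inside it, and at
  that time the regulated path $w + y$ is zero. Constancy, continuity and comparison all follow from this.
\<close>
lemma regulator_increase:
  assumes w: "continuous_on {0..} w" and st: "0 \<le> s" "s \<le> t"
  obtains "regulator w t = regulator w s"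
  | r where "s \<le> r" "r \<le> t" "regulator w t = - w r" "regulator w r = - w r"
proof -
  have "0 \<le> t" using st by simp
  then obtain r where r: "0 \<le> r" "r \<le> t" "regulator w t = max 0 (- w r)"
    by (rule regulator_attained[OF w])
  have ge_r: "- w r \<le> regulator w r" using regulator_ge[OF w r(1) order_refl] by simp
  show thesis
  proof (cases "r \<le> s \<or> - w r \<le> 0")
    case True
    then have "regulator w t \<le> regulator w s"
      using r regulator_ge[OF w r(1), of s] regulator_ge[OF w, of 0 s] st by auto
    with regulator_mono[OF w st] that(1) show thesis by simp
  next
    case False
    with r ge_r regulator_mono[OF w r(1,2)] show thesis
      by (intro that(2)[of r]) auto
  qed
qed

lemma regulator_constant:
  assumes "continuous_on {0..} w" "0 \<le> s" "s \<le> t"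
    and pos: "\<And>r. s \<le> r \<Longrightarrow> r \<le> t \<Longrightarrow> 0 < w r + regulator w r"
  shows "regulator w t = regulator w s"
  using assms(1-3)
proof (cases rule: regulator_increase)
  case (2 r)
  then show ?thesis using pos[of r] by simp
qed

lemma continuous_on_regulator:
  assumes w: "continuous_on {0..} w"
  shows "continuous_on {0..} (regulator w)"
  unfolding continuous_on_iff
proof (intro ballI allI impI)
  fix t e :: real assume "t \<in> {0..}" "0 < e"
  then obtain d where d: "d > 0" "\<And>s. 0 \<le> s \<Longrightarrow> dist s t < d \<Longrightarrow> dist (w s) (w t) < e / 2"
    using w[unfolded continuous_on_iff] by (metis atLeast_iff half_gt_zero)
  \<comment> \<open>An increase of the regulator over an interval is at most the oscillation of \<open>w\<close> there.\<close>
  have osc: "\<bar>regulator w q - regulator w p\<bar> < e"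
    if p: "0 \<le> p" "p \<le> q" and near: "dist p t < d" "dist q t < d" for p q
    using w p
  proof (cases rule: regulator_increase)
    case 1
    then show ?thesis using \<open>0 < e\<close> by simp
  next
    case (2 r)
    have "dist r t < d" using 2 near by (auto simp: dist_real_def)
    then have "dist (w r) (w t) < e / 2" "dist (w p) (w t) < e / 2"
      using d(2) 2 p near by auto
    then have "\<bar>w r - w p\<bar> < e" unfolding dist_real_def by linarith
    moreover have "- w p \<le> regulator w p" using regulator_ge[OF w p(1) order_refl] by simp
    moreover have "regulator w p \<le> regulator w q" by (rule regulator_mono[OF w p])
    ultimately show ?thesis using 2 by linarith
  qed
  show "\<exists>d>0. \<forall>s\<in>{0..}. dist s t < d \<longrightarrow> dist (regulator w s) (regulator w t) < e"
  proof (intro exI[of _ d] conjI ballI impI)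
    fix s assume s: "s \<in> {0..}" "dist s t < d"
    show "dist (regulator w s) (regulator w t) < e"
      using osc[of s t] osc[of t s] s \<open>t \<in> {0..}\<close> \<open>d > 0\<close>
      by (cases "s \<le> t") (auto simp: dist_real_def abs_minus_commute)
  qed (rule d)
qed

text \<open>
  As a supremum of functions linear in $-w$ (and of 0), the regulator is sublinear in $-w$.
\<close>
lemma regulator_sublinear:
  assumes w: "continuous_on {0..} w" "continuous_on {0..} w'"
    and "0 \<le> t" "0 \<le> p" "0 \<le> q"
    and le: "\<And>s. 0 \<le> s \<Longrightarrow> s \<le> t \<Longrightarrow> p * w s + q * w' s \<le> v s"
  shows "regulator v t \<le> p * regulator w t + q * regulator w' t"
proof (rule regulator_le)
  fix s assume s: "0 \<le> s" "s \<le> t"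
  have "- v s \<le> p * (- w s) + q * (- w' s)" using le[OF s] by simp
  also have "\<dots> \<le> p * regulator w t + q * regulator w' t"
    using regulator_ge(1)[OF _ s] w assms(4,5) by (intro add_mono mult_left_mono) auto
  finally show "- v s \<le> p * regulator w t + q * regulator w' t" .
qed (use assms regulator_ge(2)[of _ 0 t] in auto)

text \<open>
  Lowering \<open>w\<close> by a nondecreasing path \<open>c\<close> raises the regulator by at most \<open>c\<close>. Over an interval
  where the regulator of \<open>w\<close> grows, the new one grows at least as much: the old one ends at $-w(r)$,
  the new one reaches at least $-w(r) + c(r)$, and it started at most $c(s) \le c(r)$ above the old one.
\<close>
lemma regulator_comparison:
  assumes w: "continuous_on {0..} w" and w': "continuous_on {0..} (\<lambda>s. w s - c s)"
    and c: "mono_on {0..} c" "0 \<le> c 0" and st: "0 \<le> s" "s \<le> t"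
  shows "regulator (\<lambda>s. w s - c s) s \<le> regulator w s + c s"
    and "regulator w t - regulator w s
      \<le> regulator (\<lambda>s. w s - c s) t - regulator (\<lambda>s. w s - c s) s"
proof -
  have c_mono: "c p \<le> c q" if "0 \<le> p" "p \<le> q" for p q
    using mono_onD[OF c(1)] that by simp
  show le: "regulator (\<lambda>s. w s - c s) s \<le> regulator w s + c s"
  proof (rule regulator_le)
    fix r assume r: "0 \<le> r" "r \<le> s"
    then show "- (w r - c r) \<le> regulator w s + c s"
      using regulator_ge(1)[OF w r] c_mono[OF r] by simp
  qed (use st c(2) c_mono[of 0 s] regulator_ge(2)[OF w, of 0 s] in auto)
  from w st show "regulator w t - regulator w s
      \<le> regulator (\<lambda>s. w s - c s) t - regulator (\<lambda>s. w s - c s) s"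
  proof (cases rule: regulator_increase)
    case 1
    then show ?thesis using regulator_mono[OF w' st] by simp
  next
    case (2 r)
    then show ?thesis
      using regulator_ge(1)[OF w', of r t] c_mono[of s r] st le by simp
  qed
qed


section \<open>The oblique regulator\<close>

text \<open>
  The weight \<open>u\<close> makes \<open>P\<close> a contraction with factor \<open>\<rho>\<close> for the norm $\max_i |v_i| / u_i$.
\<close>
locale contracting_matrix =
  fixes P :: "real^'n^'n" and u :: "real^'n" and \<rho> :: real
  assumes P_nonneg: "0 \<le> P $ i $ j" and u_pos: "0 < u $ i"
    and rho: "0 \<le> \<rho>" "\<rho> < 1" and P_u: "(P *v u) $ i \<le> \<rho> * u $ i"
begin

lemma P_mono:
  assumes "\<And>j. v $ j \<le> w $ j"
  shows "(P *v v) $ i \<le> (P *v w) $ i"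
  unfolding matrix_vector_mult_def using assms P_nonneg
  by (auto intro!: sum_mono mult_left_mono)

lemma P_contracts:
  assumes "\<And>j. \<bar>v $ j\<bar> \<le> C * u $ j" "0 \<le> C"
  shows "\<bar>(P *v v) $ i\<bar> \<le> \<rho> * C * u $ i"
proof -
  have "(P *v v) $ i \<le> (P *v (C *\<^sub>R u)) $ i" "(P *v ((- C) *\<^sub>R u)) $ i \<le> (P *v v) $ i"
    by (intro P_mono; use assms(1) in \<open>simp add: abs_le_iff minus_le_iff\<close>)+
  then have "\<bar>(P *v v) $ i\<bar> \<le> C * (P *v u) $ i"
    unfolding matrix_vector_mult_scaleR by (simp add: abs_le_iff)
  also have "\<dots> \<le> C * (\<rho> * u $ i)" by (intro mult_left_mono P_u assms)
  finally show ?thesis by (simp add: ac_simps)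
qed

text \<open>
  Successive approximation of the pushing path. Component \<open>i\<close> regulates the input left after the
  pushing in the other directions has been routed into direction \<open>i\<close>. Non-strict
  inequalities which the step preserves pass to the limit; sublinearity and comparison are obtained so.
\<close>
primrec iterate :: "(real \<Rightarrow> real^'n) \<Rightarrow> nat \<Rightarrow> real \<Rightarrow> real^'n" where
  "iterate x 0 = (\<lambda>t. 0)"
| "iterate x (Suc n) = (\<lambda>t. \<chi> i. regulator (\<lambda>s. x s $ i - (P *v iterate x n s) $ i) t)"

definition oblique_regulator :: "(real \<Rightarrow> real^'n) \<Rightarrow> real \<Rightarrow> real^'n" where
  "oblique_regulator x t = lim (\<lambda>n. iterate x n t)"

lemma continuous_on_slack:
  assumes "continuous_on {0..} x" "continuous_on {0..} y"
  shows "continuous_on {0..} (\<lambda>s. x s $ i - (P *v y s) $ i)"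
  unfolding matrix_vector_mult_def using assms by (auto intro!: continuous_intros)

lemma continuous_on_iterate:
  assumes "continuous_on {0..} x"
  shows "continuous_on {0..} (iterate x n)"
  by (induction n)
    (auto intro!: continuous_on_vec_lambda continuous_on_regulator continuous_on_slack assms)

lemmas continuous_on_iterate_slack = continuous_on_slack[OF _ continuous_on_iterate]

text \<open>
  The regulator is 1-Lipschitz for the sup norm over $[0,T]$, so each step inherits the factor \<open>\<rho>\<close> of \<open>P\<close>.
\<close>
lemma iterate_geometric:
  assumes x: "continuous_on {0..} x"
  obtains K where "0 \<le> K"
    "\<And>n t i. 0 \<le> t \<Longrightarrow> t \<le> T \<Longrightarrow> \<bar>(iterate x (Suc n) t - iterate x n t) $ i\<bar> \<le> \<rho> ^ n * K * u $ i"
proof (cases "0 \<le> T")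
  case True
  define m where "m i = regulator (\<lambda>s. x s $ i) T / u $ i" for i
  define K where "K = sum m UNIV"
  have xi: "continuous_on {0..} (\<lambda>s. x s $ i)" for i
    using x by (intro continuous_intros)
  have m_nonneg: "0 \<le> m i" for i
    unfolding m_def using regulator_ge(2)[OF xi True order_refl, of i] u_pos[of i] by simp
  then have K: "0 \<le> K" "m i \<le> K" for i
    unfolding K_def by (auto intro!: sum_nonneg member_le_sum)
  have "\<bar>(iterate x (Suc n) t - iterate x n t) $ i\<bar> \<le> \<rho> ^ n * K * u $ i" if "0 \<le> t" "t \<le> T" for n t i
    using that
  proof (induction n arbitrary: t i)
    case 0
    have "0 \<le> regulator (\<lambda>s. x s $ i) t"
      using regulator_ge(2)[OF xi 0(1) order_refl] .
    moreover have "regulator (\<lambda>s. x s $ i) t \<le> regulator (\<lambda>s. x s $ i) T"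
      by (intro regulator_mono xi 0)
    moreover have "regulator (\<lambda>s. x s $ i) T = m i * u $ i"
      using u_pos[of i] by (simp add: m_def)
    moreover have "m i * u $ i \<le> K * u $ i"
      using K(2)[of i] u_pos[of i] by (simp add: mult_right_mono)
    ultimately show ?case by simp
  next
    case (Suc n)
    have "\<bar>regulator (\<lambda>s. x s $ i - (P *v iterate x (Suc n) s) $ i) t
         - regulator (\<lambda>s. x s $ i - (P *v iterate x n s) $ i) t\<bar> \<le> \<rho> * (\<rho> ^ n * K) * u $ i"
    proof (rule regulator_lipschitz)
      fix s assume "0 \<le> s" "s \<le> t"
      then have "\<bar>(P *v (iterate x (Suc n) s - iterate x n s)) $ i\<bar> \<le> \<rho> * (\<rho> ^ n * K) * u $ i"
        using Suc.prems K(1) rho(1) by (intro P_contracts Suc.IH) auto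
      then show "\<bar>x s $ i - (P *v iterate x (Suc n) s) $ i - (x s $ i - (P *v iterate x n s) $ i)\<bar>
          \<le> \<rho> * (\<rho> ^ n * K) * u $ i"
        by (simp add: matrix_vector_mult_diff_distrib abs_minus_commute)
    qed (use Suc.prems in \<open>auto intro!: continuous_on_iterate_slack[OF x x] simp del: iterate.simps\<close>)
    then show ?case by (simp add: ac_simps)
  qed
  with K(1) show thesis by (rule that)
next
  case False
  then show thesis by (intro that[of 0]) auto
qed

lemma uniform_limit_iterate:
  assumes x: "continuous_on {0..} x"
  shows "uniform_limit {0..T} (iterate x) (oblique_regulator x) sequentially"
proof -
  obtain K where K: "0 \<le> K"
    "\<And>n t i. 0 \<le> t \<Longrightarrow> t \<le> T \<Longrightarrow> \<bar>(iterate x (Suc n) t - iterate x n t) $ i\<bar> \<le> \<rho> ^ n * K * u $ i"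
    using iterate_geometric[OF x] by metis
  define y where "y t = (\<Sum>n. iterate x (Suc n) t - iterate x n t)" for t
  have "uniform_limit {0..T} (\<lambda>n t. \<Sum>k<n. iterate x (Suc k) t - iterate x k t) y sequentially"
    unfolding y_def
  proof (rule Weierstrass_m_test)
    fix n t assume "t \<in> {0..T}"
    have "norm (iterate x (Suc n) t - iterate x n t)
        \<le> (\<Sum>i\<in>UNIV. \<bar>(iterate x (Suc n) t - iterate x n t) $ i\<bar>)"
      by (rule norm_le_l1_cart)
    also have "\<dots> \<le> (\<Sum>i\<in>UNIV. \<rho> ^ n * K * u $ i)"
      using \<open>t \<in> {0..T}\<close> by (intro sum_mono K) auto
    finally show "norm (iterate x (Suc n) t - iterate x n t) \<le> \<rho> ^ n * (K * (\<Sum>i\<in>UNIV. u $ i))"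
      by (simp add: sum_distrib_left mult.assoc)
  next
    show "summable (\<lambda>n. \<rho> ^ n * (K * (\<Sum>i\<in>UNIV. u $ i)))"
      using rho by (intro summable_mult2 summable_geometric) auto
  qed
  moreover have "(\<Sum>k<n. iterate x (Suc k) t - iterate x k t) = iterate x n t" for n t
    using sum_lessThan_telescope[of "\<lambda>k. iterate x k t" n] by (simp only: iterate.simps(1) diff_zero)
  ultimately have lim: "uniform_limit {0..T} (iterate x) y sequentially"
    by (simp only:)
  have "oblique_regulator x t = y t" if "t \<in> {0..T}" for t
    unfolding oblique_regulator_def using tendsto_uniform_limitI[OF lim that] by (rule limI)
  then show ?thesis using lim by (subst uniform_limit_cong') auto
qed

lemma iterate_tendsto:
  assumes "continuous_on {0..} x" "0 \<le> t"
  shows "(\<lambda>n. iterate x n t $ i) \<longlonglongrightarrow> oblique_regulator x t $ i"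
  by (intro tendsto_vec_nth tendsto_uniform_limitI[OF uniform_limit_iterate[OF assms(1), of t]])
    (use assms in auto)

lemma continuous_on_oblique_regulator:
  assumes x: "continuous_on {0..} x"
  shows "continuous_on {0..} (oblique_regulator x)"
proof -
  have "continuous_on {0..T} (oblique_regulator x)" for T
    by (rule uniform_limit_theorem[OF _ uniform_limit_iterate[OF x]])
      (auto intro!: always_eventually continuous_on_subset[OF continuous_on_iterate[OF x]])
  then have "continuous (at t within {0..}) (oblique_regulator x)" if "0 \<le> t" for t
  proof -
    have "continuous (at t within {0..t+1}) (oblique_regulator x)"
      using \<open>continuous_on {0..t+1} _\<close> that by (simp add: continuous_on_eq_continuous_within)
    moreover have "at t within {0..t+1} = at t within {0..}"
      by (rule at_within_nhd[of _ "{..<t+1}"]) auto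
    ultimately show ?thesis by simp
  qed
  then show ?thesis by (simp add: continuous_on_eq_continuous_within)
qed

lemmas continuous_on_oblique_slack = continuous_on_slack[OF _ continuous_on_oblique_regulator]

lemma oblique_regulator_fixpoint:
  assumes x: "continuous_on {0..} x" and "0 \<le> t"
  shows "oblique_regulator x t $ i = regulator (\<lambda>s. x s $ i - (P *v oblique_regulator x s) $ i) t"
proof -
  have lim: "uniform_limit {0..t} (\<lambda>n s. P *v iterate x n s) (\<lambda>s. P *v oblique_regulator x s) sequentially"
    by (intro bounded_linear.uniform_limit[OF matrix_vector_mul_bounded_linear]
        uniform_limit_iterate[OF x])
  have "(\<lambda>n. iterate x (Suc n) t $ i)
      \<longlonglongrightarrow> regulator (\<lambda>s. x s $ i - (P *v oblique_regulator x s) $ i) t"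
    unfolding tendsto_iff
  proof (intro allI impI)
    fix e :: real assume "0 < e"
    then have "\<forall>\<^sub>F n in sequentially. \<forall>s\<in>{0..t}.
        dist (P *v iterate x n s) (P *v oblique_regulator x s) < e / 2"
      using lim[unfolded uniform_limit_iff] half_gt_zero by blast
    then show "\<forall>\<^sub>F n in sequentially. dist (iterate x (Suc n) t $ i)
        (regulator (\<lambda>s. x s $ i - (P *v oblique_regulator x s) $ i) t) < e"
    proof eventually_elim
      case (elim n)
      have "\<bar>regulator (\<lambda>s. x s $ i - (P *v iterate x n s) $ i) t -
          regulator (\<lambda>s. x s $ i - (P *v oblique_regulator x s) $ i) t\<bar> \<le> e / 2"
      proof (rule regulator_lipschitz)
        fix s assume "0 \<le> s" "s \<le> t"
        then have "norm (P *v iterate x n s - P *v oblique_regulator x s) < e / 2"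
          using elim by (auto simp: dist_norm)
        then show "\<bar>x s $ i - (P *v iterate x n s) $ i - (x s $ i - (P *v oblique_regulator x s) $ i)\<bar>
            \<le> e / 2"
          using component_le_norm_cart[of "P *v iterate x n s - P *v oblique_regulator x s" i]
            unfolding vector_minus_component by linarith
      qed (use assms in \<open>auto intro!: continuous_on_iterate_slack continuous_on_oblique_slack\<close>)
      then show ?case using \<open>0 < e\<close> by (simp add: dist_real_def)
    qed
  qed
  with LIMSEQ_Suc[OF iterate_tendsto[OF assms]] show ?thesis by (rule LIMSEQ_unique)
qed

text \<open>
  Pushing in direction \<open>i\<close> takes place only when the reflected path is on the face $z_i = 0$; this is
  the pathwise form of complementarity.
\<close>
lemma oblique_regulator_constant:
  assumes x: "continuous_on {0..} x" and st: "0 \<le> s" "s \<le> t"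
    and pos: "\<And>r. s \<le> r \<Longrightarrow> r \<le> t
      \<Longrightarrow> 0 < x r $ i - (P *v oblique_regulator x r) $ i + oblique_regulator x r $ i"
  shows "oblique_regulator x t $ i = oblique_regulator x s $ i"
proof -
  let ?w = "\<lambda>r. x r $ i - (P *v oblique_regulator x r) $ i"
  have fix_r: "oblique_regulator x r $ i = regulator ?w r" if "0 \<le> r" for r
    by (rule oblique_regulator_fixpoint[OF x that])
  have "0 < ?w r + regulator ?w r" if "s \<le> r" "r \<le> t" for r
    using pos[OF that] fix_r[of r] st(1) that by simp
  with regulator_constant[OF continuous_on_oblique_slack[OF x x] st]
  show ?thesis using fix_r[of s] fix_r[of t] st by simp
qed

lemma oblique_regulator_zero:
  assumes x: "continuous_on {0..} x" "0 \<le> x 0"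
  shows "oblique_regulator x 0 = 0"
proof -
  have "iterate x n 0 = 0" for n
  proof (induction n)
    case (Suc n)
    have "regulator (\<lambda>s. x s $ i - (P *v iterate x n s) $ i) 0 = 0" for i
      using Suc x(2) by (intro regulator_zero) (simp add: less_eq_vec_def)
    then show ?case by (simp add: vec_eq_iff)
  qed simp
  then show ?thesis
    using iterate_tendsto[OF x(1), of 0] by (auto simp: vec_eq_iff LIMSEQ_const_iff)
qed

text \<open>
  The iteration step preserves sublinearity because \<open>P\<close> is monotone. When \<open>x\<close> and \<open>x'\<close> are two
  perturbations of one path and \<open>v\<close> is a perturbation of intermediate size, this is convexity in the size.
\<close>
lemma oblique_regulator_sublinear:
  assumes x: "continuous_on {0..} x" "continuous_on {0..} x'" "continuous_on {0..} v"
    and "0 \<le> t" "0 \<le> p" "0 \<le> q"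
    and le: "\<And>s i. 0 \<le> s \<Longrightarrow> p * x s $ i + q * x' s $ i \<le> v s $ i"
  shows "oblique_regulator v t $ i \<le> p * oblique_regulator x t $ i + q * oblique_regulator x' t $ i"
proof -
  have "iterate v n t $ i \<le> p * iterate x n t $ i + q * iterate x' n t $ i" if "0 \<le> t" for n t i
    using that
  proof (induction n arbitrary: t i)
    case (Suc n)
    have "regulator (\<lambda>s. v s $ i - (P *v iterate v n s) $ i) t
        \<le> p * regulator (\<lambda>s. x s $ i - (P *v iterate x n s) $ i) t
        + q * regulator (\<lambda>s. x' s $ i - (P *v iterate x' n s) $ i) t"
    proof (rule regulator_sublinear)
      fix s assume "0 \<le> s" "s \<le> t"
      then have "(P *v iterate v n s) $ i \<le> (P *v (p *\<^sub>R iterate x n s + q *\<^sub>R iterate x' n s)) $ i"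
        using Suc.IH by (intro P_mono) simp
      then show "p * (x s $ i - (P *v iterate x n s) $ i) + q * (x' s $ i - (P *v iterate x' n s) $ i)
          \<le> v s $ i - (P *v iterate v n s) $ i"
        using le[OF \<open>0 \<le> s\<close>, of i]
        by (simp add: matrix_vector_right_distrib matrix_vector_mult_scaleR algebra_simps)
    qed (use assms Suc.prems in \<open>auto intro!: continuous_on_iterate_slack\<close>)
    then show ?case by simp
  qed simp
  then have le_n: "iterate v n t $ i \<le> p * iterate x n t $ i + q * iterate x' n t $ i" for n
    using \<open>0 \<le> t\<close> by blast
  have "(\<lambda>n. p * iterate x n t $ i + q * iterate x' n t $ i)
      \<longlonglongrightarrow> p * oblique_regulator x t $ i + q * oblique_regulator x' t $ i"
    by (intro tendsto_intros iterate_tendsto assms)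
  from LIMSEQ_le[OF iterate_tendsto[OF x(3) \<open>0 \<le> t\<close>] this] le_n show ?thesis by blast
qed

text \<open>
  The one-dimensional comparison applies at each step with the subtracted path
  $c_i + (P (y' - y))_i$, which is nondecreasing as soon as $y' - y$ is. The last claim says that the
  reflected path of $x - c$ lies below that of \<open>x\<close>.
\<close>
lemma oblique_regulator_comparison:
  assumes x: "continuous_on {0..} x" and c: "continuous_on {0..} c"
    and c_mono: "mono_on {0..} c" and c_zero: "0 \<le> c 0"
  defines "y \<equiv> oblique_regulator x" and "y' \<equiv> oblique_regulator (\<lambda>t. x t - c t)"
  shows "mono_on {0..} (\<lambda>t. y' t $ i - y t $ i)"
    and "0 \<le> y' 0 $ i - y 0 $ i"
    and "0 \<le> t \<Longrightarrow> y' t $ i - (P *v y' t) $ i \<le> y t $ i - (P *v y t) $ i + c t $ i"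
proof -
  let ?x' = "\<lambda>t. x t - c t"
  have x': "continuous_on {0..} ?x'" using x c by (intro continuous_intros)
  have ci_mono: "mono_on {0..} (\<lambda>s. c s $ i)" "0 \<le> c 0 $ i" for i
    using c_mono c_zero by (auto simp: mono_on_def less_eq_vec_def)
  have cost_mono: "mono_on {0..} (\<lambda>s. c s $ i + (P *v (g s - f s)) $ i)"
    and cost_zero: "0 \<le> c 0 $ i + (P *v (g 0 - f 0)) $ i"
    if "\<And>j. mono_on {0..} (\<lambda>t. g t $ j - f t $ j)" "\<And>j. 0 \<le> g 0 $ j - f 0 $ j" for f g i
  proof -
    show "mono_on {0..} (\<lambda>s. c s $ i + (P *v (g s - f s)) $ i)"
      using mono_onD[OF that(1)]
      by (intro mono_onI add_mono mono_onD[OF ci_mono(1)] P_mono) auto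
    have "0 \<le> (P *v (g 0 - f 0)) $ i" using P_mono[of 0 "g 0 - f 0" i] that(2) by simp
    then show "0 \<le> c 0 $ i + (P *v (g 0 - f 0)) $ i" using ci_mono(2)[of i] by simp
  qed
  have cost_eq: "?x' s $ i - (P *v g s) $ i
      = (x s $ i - (P *v f s) $ i) - (c s $ i + (P *v (g s - f s)) $ i)" for f g s i
    by (simp add: matrix_vector_mult_diff_distrib)
  have iter: "mono_on {0..} (\<lambda>t. iterate ?x' n t $ i - iterate x n t $ i)
      \<and> 0 \<le> iterate ?x' n 0 $ i - iterate x n 0 $ i" for n i
  proof (induction n arbitrary: i)
    case 0
    show ?case by (simp add: mono_on_def)
  next
    case (Suc n)
    let ?w = "\<lambda>s. x s $ i - (P *v iterate x n s) $ i"
    let ?c = "\<lambda>s. c s $ i + (P *v (iterate ?x' n s - iterate x n s)) $ i"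
    have w: "continuous_on {0..} ?w" by (rule continuous_on_iterate_slack[OF x x])
    have w': "continuous_on {0..} (\<lambda>s. ?w s - ?c s)"
      unfolding cost_eq[symmetric] by (rule continuous_on_iterate_slack[OF x' x'])
    have it: "iterate ?x' (Suc n) t $ i = regulator (\<lambda>s. ?w s - ?c s) t" for t
      by (simp only: iterate.simps vec_lambda_beta cost_eq[of _ _ _ "iterate x n"])
    note cost = cost_mono[of "iterate ?x' n" "iterate x n" i] cost_zero[of "iterate ?x' n" "iterate x n" i]
    have mono: "mono_on {0..} ?c" and zero: "0 \<le> ?c 0" using Suc cost by blast+
    have "mono_on {0..} (\<lambda>t. regulator (\<lambda>s. ?w s - ?c s) t - regulator ?w t)"
      by (intro mono_onI) (use regulator_comparison(2)[OF w w' mono zero] in \<open>force simp: algebra_simps\<close>)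
    moreover have "regulator ?w 0 \<le> regulator (\<lambda>s. ?w s - ?c s) 0"
      using regulator_ge[OF w', of 0 0] zero by (intro regulator_le) auto
    ultimately show ?case by (simp only: it) simp
  qed
  have y_lim: "(\<lambda>n. iterate ?x' n t $ i - iterate x n t $ i) \<longlonglongrightarrow> y' t $ i - y t $ i" if "0 \<le> t" for t i
    unfolding y_def y'_def using that x x' by (intro tendsto_intros iterate_tendsto)
  show mono: "mono_on {0..} (\<lambda>t. y' t $ i - y t $ i)" for i
  proof (rule mono_onI)
    fix r s :: real assume rs: "r \<in> {0..}" "s \<in> {0..}" "r \<le> s"
    have "iterate ?x' n r $ i - iterate x n r $ i \<le> iterate ?x' n s $ i - iterate x n s $ i" for n
      using mono_onD[OF conjunct1[OF iter] rs] .
    then show "y' r $ i - y r $ i \<le> y' s $ i - y s $ i"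
      using LIMSEQ_le[OF y_lim y_lim, of r s i i] rs by simp
  qed
  show zero: "0 \<le> y' 0 $ i - y 0 $ i" for i
    using iter by (intro LIMSEQ_le_const[OF y_lim]) auto
  assume "0 \<le> t"
  let ?w = "\<lambda>s. x s $ i - (P *v y s) $ i"
  let ?c = "\<lambda>s. c s $ i + (P *v (y' s - y s)) $ i"
  have w: "continuous_on {0..} ?w" unfolding y_def by (rule continuous_on_oblique_slack[OF x x])
  have w': "continuous_on {0..} (\<lambda>s. ?w s - ?c s)"
    unfolding cost_eq[symmetric] y'_def by (rule continuous_on_oblique_slack[OF x' x'])
  have "regulator (\<lambda>s. ?w s - ?c s) t \<le> regulator ?w t + ?c t"
    using \<open>0 \<le> t\<close> by (intro regulator_comparison(1)[OF w w'] cost_mono cost_zero mono zero) auto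
  moreover have "y' t $ i = regulator (\<lambda>s. ?w s - ?c s) t"
    using oblique_regulator_fixpoint[OF x' \<open>0 \<le> t\<close>, of i]
    by (simp only: y'_def[symmetric] cost_eq[of _ _ _ y])
  moreover have "y t $ i = regulator ?w t"
    using oblique_regulator_fixpoint[OF x \<open>0 \<le> t\<close>] by (simp add: y_def)
  ultimately show "y' t $ i - (P *v y' t) $ i \<le> y t $ i - (P *v y t) $ i + c t $ i"
    by (simp add: matrix_vector_mult_diff_distrib)
qed

end


section \<open>Complementarity and uniqueness of the reflection\<close>

lemma cadlag_cong:
  assumes "\<And>t. 0 \<le> t \<Longrightarrow> f t = g t"
  shows "cadlag f \<longleftrightarrow> cadlag g"
proof -
  have "(f \<longlongrightarrow> f t) (at_right t) \<longleftrightarrow> (g \<longlongrightarrow> g t) (at_right t)" if "0 \<le> t" for t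
    unfolding assms[OF that]
    by (intro filterlim_cong refl eventually_mono[OF eventually_at_right_less[of t]] assms)
      (use that in auto)
  moreover have "(f \<longlongrightarrow> l) (at_left t) \<longleftrightarrow> (g \<longlongrightarrow> l) (at_left t)" if "0 < t" for t l
    by (intro filterlim_cong refl eventually_mono[OF eventually_at_left_real[OF that]] assms) auto
  ultimately show ?thesis by (simp add: cadlag_def)
qed

lemma continuous_on_imp_cadlag:
  fixes f :: "real \<Rightarrow> 'a::topological_space"
  assumes "continuous_on {0..} f"
  shows "cadlag f"
proof -
  have lim: "(f \<longlongrightarrow> f t) (at t within {0..})" if "0 \<le> t" for t
    using assms that by (auto simp: continuous_on)
  have "(f \<longlongrightarrow> f t) (at_right t)" if "0 \<le> t" for t
    by (rule tendsto_within_subset[OF lim]) (use that in auto)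
  moreover have "(f \<longlongrightarrow> f t) (at_left t)" if "0 < t" for t
  proof -
    have "at t within {0..} = at t"
      using that by (intro at_within_nhd[of _ "{0<..}"]) auto
    then show ?thesis using lim[of t] that by (simp add: filterlim_at_split)
  qed
  ultimately show ?thesis unfolding cadlag_def by blast
qed

text \<open>
  The constant extension to negative times used in \<open>stieltjes\<close> has the two properties required of
  a generating function of an interval measure.
\<close>
lemma extended_path:
  fixes f :: "real \<Rightarrow> real"
  assumes mono: "mono_on {0..} f" and rc: "\<And>t. 0 \<le> t \<Longrightarrow> (f \<longlongrightarrow> f t) (at_right t)"
  shows "s \<le> t \<Longrightarrow> f (max s 0) \<le> f (max t 0)"
    and "continuous (at_right a) (\<lambda>s. f (max s 0))"
proof -
  show "f (max s 0) \<le> f (max t 0)" if "s \<le> t"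
    using that by (intro mono_onD[OF mono]) auto
  show "continuous (at_right a) (\<lambda>s. f (max s 0))"
  proof (cases "0 \<le> a")
    case True
    have "((\<lambda>s. f (max s 0)) \<longlongrightarrow> f a) (at_right a) \<longleftrightarrow> (f \<longlongrightarrow> f a) (at_right a)"
      by (intro filterlim_cong refl eventually_mono[OF eventually_at_right_less[of a]])
        (use True in auto)
    then show ?thesis using True rc[OF True] by (simp add: continuous_within)
  next
    case False
    have "((\<lambda>s. f (max s 0)) \<longlongrightarrow> f 0) (at_right a)"
      by (intro tendsto_eventually eventually_mono[OF eventually_at_right_real[of a 0]])
        (use False in auto)
    then show ?thesis using False by (simp add: continuous_within)
  qed
qed

lemma emeasure_extended_path_Ioc:
  fixes f :: "real \<Rightarrow> real"
  assumes "mono_on {0..} f" "\<And>t. 0 \<le> t \<Longrightarrow> (f \<longlongrightarrow> f t) (at_right t)" "s \<le> t"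
  shows "emeasure (interval_measure (\<lambda>s. f (max s 0))) {s<..t} = ennreal (f (max t 0) - f (max s 0))"
  by (rule emeasure_interval_measure_Ioc[OF assms(3)]) (intro extended_path assms; simp)+

text \<open>
  The set where \<open>v\<close> is positive is covered by the countably many rational half-open intervals on which
  the extended path has no increment; for the time 0 the interval starts at a negative rational.
\<close>
lemma integral_zero_if_locally_constant:
  fixes v f :: "real \<Rightarrow> real"
  assumes v: "continuous_on {0..} v"
    and f: "mono_on {0..} f" "\<And>t. 0 \<le> t \<Longrightarrow> (f \<longlongrightarrow> f t) (at_right t)"
    and const: "\<And>s t. 0 \<le> s \<Longrightarrow> s \<le> t \<Longrightarrow> (\<And>r. s \<le> r \<Longrightarrow> r \<le> t \<Longrightarrow> 0 < v r) \<Longrightarrow> f t = f s"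
  shows "(\<integral>\<^sup>+t\<in>{0..}. ennreal (v t) \<partial>interval_measure (\<lambda>s. f (max s 0))) = 0"
proof -
  let ?M = "interval_measure (\<lambda>s. f (max s 0))"
  define I where "I = {(p, q). p \<in> \<rat> \<and> q \<in> \<rat> \<and> p < q \<and> f (max p 0) = f (max q 0)}"
  define N where "N = (\<Union>(p, q)\<in>I. {p<..q})"
  have "countable I"
    by (rule countable_subset[of _ "\<rat> \<times> \<rat>"]) (auto simp: I_def intro: countable_rat)
  have "{p<..q} \<in> null_sets ?M" if "(p, q) \<in> I" for p q
    using that emeasure_extended_path_Ioc[OF f, of p q] by (auto simp: I_def null_sets_def)
  then have "N \<in> null_sets ?M"
    unfolding N_def using \<open>countable I\<close> by (auto intro!: null_sets_UN')
  moreover have "t \<in> N" if t: "0 \<le> t" "0 < v t" for t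
  proof -
    obtain d where d: "d > 0" "\<And>s. 0 \<le> s \<Longrightarrow> dist s t < d \<Longrightarrow> dist (v s) (v t) < v t"
      using v[unfolded continuous_on_iff] t by (metis atLeast_iff)
    have pos: "0 < v s" if "0 \<le> s" "dist s t < d" for s
      using d(2)[OF that] by (auto simp: dist_real_def)
    obtain p where p: "p \<in> \<rat>" "t - d < p" "p < t"
      using Rats_dense_in_real[of "t - d" t] d(1) by auto
    obtain q where q: "q \<in> \<rat>" "t < q" "q < t + d"
      using Rats_dense_in_real[of t "t + d"] d(1) by auto
    have "f (max q 0) = f (max p 0)"
      using p q t by (intro const pos) (auto simp: dist_real_def)
    then have "(p, q) \<in> I" using p q by (auto simp: I_def)
    then show ?thesis unfolding N_def by (rule UN_I) (use p q in simp)
  qed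
  ultimately have "AE t in ?M. ennreal (v t) * indicator {0..} t = 0"
    by (intro AE_I'[of N]) (auto simp: indicator_def ennreal_eq_0_iff not_le)
  then have "(\<integral>\<^sup>+t\<in>{0..}. ennreal (v t) \<partial>?M) = (\<integral>\<^sup>+t. 0 \<partial>?M)"
    by (rule nn_integral_cong_AE)
  then show ?thesis by simp
qed

lemma stieltjes_zero_if_locally_constant:
  fixes v w :: "real \<Rightarrow> real^'n"
  assumes v: "continuous_on {0..} v"
    and w: "mono_on {0..} w" "\<And>t. 0 \<le> t \<Longrightarrow> (w \<longlongrightarrow> w t) (at_right t)"
    and const: "\<And>i s t. 0 \<le> s \<Longrightarrow> s \<le> t \<Longrightarrow> (\<And>r. s \<le> r \<Longrightarrow> r \<le> t \<Longrightarrow> 0 < v r $ i)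
      \<Longrightarrow> w t $ i = w s $ i"
  shows "stieltjes v w = 0"
  unfolding stieltjes_def
proof (intro sum.neutral ballI integral_zero_if_locally_constant const tendsto_vec_nth w)
  show "continuous_on {0..} (\<lambda>t. v t $ i)" for i using v by (intro continuous_intros)
  show "mono_on {0..} (\<lambda>t. w t $ i)" for i
    using w(1) by (auto simp: mono_on_def less_eq_vec_def)
qed

text \<open>
  Converse direction of the one-dimensional Skorohod problem for paths which may jump. If \<open>y t\<close> exceeded
  \<open>c\<close>, take a level $c'$ strictly between them. After the first time $\sigma$ at which \<open>y\<close> reaches $c'$,
  the path \<open>z\<close> is at least $c' - c > 0$, so \<open>dy\<close> has no mass on $[\sigma, t]$, an atom at $\sigma$
  included. All the mass lies before $\sigma$, where \<open>y\<close> is below $c'$, which contradicts $y(t) > c'$.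
\<close>
lemma complementary_path_minimal:
  fixes y z :: "real \<Rightarrow> real"
  assumes y: "mono_on {0..} y" "\<And>t. 0 \<le> t \<Longrightarrow> (y \<longlongrightarrow> y t) (at_right t)" "y 0 = 0"
    and int: "(\<integral>\<^sup>+t\<in>{0..}. ennreal (z t) \<partial>interval_measure (\<lambda>s. y (max s 0))) = 0"
    and "0 \<le> t" "0 \<le> c" and le: "\<And>s. 0 \<le> s \<Longrightarrow> s \<le> t \<Longrightarrow> y s - z s \<le> c"
  shows "y t \<le> c"
proof (rule ccontr)
  assume "\<not> y t \<le> c"
  define c' where "c' = (c + y t) / 2"
  have c': "c < c'" "c' < y t" using \<open>\<not> y t \<le> c\<close> by (auto simp: c'_def)
  let ?M = "interval_measure (\<lambda>s. y (max s 0))"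
  define A where "A = {s. 0 \<le> s \<and> c' \<le> y s}"
  define \<sigma> where "\<sigma> = Inf A"
  have "t \<in> A" using \<open>0 \<le> t\<close> c' by (simp add: A_def)
  have bdd: "bdd_below A" by (rule bdd_belowI[of _ 0]) (simp add: A_def)
  have "0 \<le> \<sigma>" unfolding \<sigma>_def using \<open>t \<in> A\<close> by (intro cInf_greatest) (auto simp: A_def)
  have "\<sigma> \<le> t" unfolding \<sigma>_def by (rule cInf_lower[OF \<open>t \<in> A\<close> bdd])
  have above: "c' \<le> y s" if gt: "\<sigma> < s" for s
  proof -
    obtain a where "a \<in> A" "a < s" 
      using cInf_lessD[of A s] gt \<open>t \<in> A\<close> unfolding \<sigma>_def by blast
    then show ?thesis using mono_onD[OF y(1), of a s] by (auto simp: A_def)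
  qed
  have "c' \<le> y \<sigma>"
    by (rule tendsto_lowerbound[OF y(2)[OF \<open>0 \<le> \<sigma>\<close>]])
      (auto intro: above eventually_mono[OF eventually_at_right_less])
  then have "0 < \<sigma>" using \<open>0 \<le> \<sigma>\<close> y(3) \<open>0 \<le> c\<close> c' by (cases "\<sigma> = 0") auto
  have below: "y s < c'" if "0 \<le> s" "s < \<sigma>" for s
    using that cInf_lower[OF _ bdd, of s] by (force simp: A_def \<sigma>_def)
  have "emeasure ?M {\<sigma>..t} = 0"
  proof -
    have "ennreal (c' - c) * emeasure ?M {\<sigma>..t} = (\<integral>\<^sup>+s. ennreal (c' - c) * indicator {\<sigma>..t} s \<partial>?M)"
      by (subst nn_integral_cmult_indicator) auto
    also have "\<dots> \<le> (\<integral>\<^sup>+t\<in>{0..}. ennreal (z t) \<partial>?M)"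
    proof (rule nn_integral_mono)
      fix s
      show "ennreal (c' - c) * indicator {\<sigma>..t} s \<le> ennreal (z s) * indicator {0..} s"
      proof (cases "s \<in> {\<sigma>..t}")
        case True
        then have "c' \<le> y s" using above \<open>c' \<le> y \<sigma>\<close> by (cases "s = \<sigma>") auto
        moreover have "y s - z s \<le> c" using True \<open>0 \<le> \<sigma>\<close> by (intro le) auto
        ultimately show ?thesis using True \<open>0 \<le> \<sigma>\<close> by (auto intro!: ennreal_leI)
      qed simp
    qed
    finally show ?thesis using int c' by (simp add: ennreal_eq_0_iff)
  qed
  moreover have "emeasure ?M {0<..<\<sigma>} \<le> ennreal c'"
  proof -
    \<comment> \<open>Exhaustion from below, since \<open>y\<close> may jump at \<open>\<sigma>\<close> and only its values before \<open>\<sigma>\<close> are below \<open>c'\<close>.\<close>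
    let ?B = "\<lambda>n. {0<..\<sigma> - 1 / real (Suc n)}"
    have "s \<in> (\<Union>n. ?B n)" if "s \<in> {0<..<\<sigma>}" for s
    proof -
      have "0 < \<sigma> - s" using that by simp
      then obtain n where "1 / real (Suc n) < \<sigma> - s" by (rule nat_approx_posE)
      then show ?thesis using that by (auto intro!: exI[of _ n])
    qed
    moreover have "s < \<sigma>" if "s \<in> ?B n" for s n
    proof -
      have "0 < 1 / real (Suc n)" by simp
      with that show ?thesis unfolding greaterThanAtMost_iff by linarith
    qed
    ultimately have "{0<..<\<sigma>} = (\<Union>n. ?B n)" by fastforce
    also have "emeasure ?M (\<Union>n. ?B n) = (SUP n. emeasure ?M (?B n))"
    proof (intro SUP_emeasure_incseq[symmetric])
      show "incseq ?B"
      proof (intro incseq_SucI subsetI)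
        fix n s assume "s \<in> ?B n"
        moreover have "1 / real (Suc (Suc n)) \<le> 1 / real (Suc n)" by (rule frac_le) auto
        ultimately show "s \<in> ?B (Suc n)" unfolding greaterThanAtMost_iff by linarith
      qed
    qed auto
    also have "\<dots> \<le> ennreal c'"
    proof (rule SUP_least)
      fix n
      let ?s = "\<sigma> - 1 / real (Suc n)"
      show "emeasure ?M (?B n) \<le> ennreal c'"
      proof (cases "0 \<le> ?s")
        case True
        then have "emeasure ?M (?B n) = ennreal (y ?s)"
          using emeasure_extended_path_Ioc[OF y(1,2) True] y(3) by simp
        moreover have "y ?s < c'" by (rule below[OF True]) simp
        ultimately show ?thesis by (simp add: ennreal_leI)
      qed simp
    qed
    finally show ?thesis .
  qed
  moreover have "ennreal (y t) = emeasure ?M {0<..t}"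
    using emeasure_extended_path_Ioc[OF y(1,2) \<open>0 \<le> t\<close>] y(3) \<open>0 \<le> t\<close> by simp
  moreover have "{0<..t} = {0<..<\<sigma>} \<union> {\<sigma>..t}"
    using \<open>0 < \<sigma>\<close> \<open>\<sigma> \<le> t\<close> by auto
  moreover have "emeasure ?M ({0<..<\<sigma>} \<union> {\<sigma>..t}) \<le> emeasure ?M {0<..<\<sigma>} + emeasure ?M {\<sigma>..t}"
    by (rule emeasure_subadditive) auto
  ultimately have "ennreal (y t) \<le> ennreal c'" by (metis add.right_neutral order_trans)
  then show False using c' \<open>0 \<le> c\<close> by (simp add: ennreal_le_iff)
qed

lemma oblique_reflection_cong:
  assumes y: "\<And>t. 0 \<le> t \<Longrightarrow> y t = y' t" and z: "\<And>t. 0 \<le> t \<Longrightarrow> z t = z' t"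
  shows "oblique_reflection R x y z \<longleftrightarrow> oblique_reflection R x y' z'"
proof -
  have "stieltjes z y = stieltjes z' y'"
    unfolding stieltjes_def
    by (intro sum.cong refl nn_integral_cong arg_cong2[where f = nn_integral] ext
        arg_cong[where f = interval_measure])
      (auto simp: y z indicator_def)
  moreover have "cadlag y = cadlag y'" "cadlag z = cadlag z'"
    using y z by (auto intro!: cadlag_cong)
  moreover have "mono_on {0..} y = mono_on {0..} y'"
    using y by (auto simp: mono_on_def)
  ultimately show ?thesis
    using y z by (simp add: oblique_reflection_def)
qed

context contracting_matrix
begin

lemma reflection_component:
  "(x + (mat 1 - P) *v y) $ i = x $ i - (P *v y) $ i + y $ i"
  by (simp add: matrix_vector_mult_diff_rdistrib)

lemma oblique_regulator_reflects:
  assumes x: "continuous_on {0..} x" "0 \<le> x 0"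
  defines "y \<equiv> oblique_regulator x"
  shows "oblique_reflection (mat 1 - P) x y (\<lambda>t. x t + (mat 1 - P) *v y t)"
proof -
  let ?w = "\<lambda>i s. x s $ i - (P *v y s) $ i"
  let ?z = "\<lambda>t. x t + (mat 1 - P) *v y t"
  have w: "continuous_on {0..} (?w i)" for i
    unfolding y_def by (rule continuous_on_oblique_slack[OF x(1) x(1)])
  have y: "y t $ i = regulator (?w i) t" if "0 \<le> t" for t i
    unfolding y_def by (rule oblique_regulator_fixpoint[OF x(1) that])
  have cont_y: "continuous_on {0..} y"
    unfolding y_def by (rule continuous_on_oblique_regulator[OF x(1)])
  have cont_z: "continuous_on {0..} ?z"
    using x(1) cont_y by (intro continuous_intros
        bounded_linear.continuous_on[OF matrix_vector_mul_bounded_linear])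
  have mono_y: "mono_on {0..} y"
    by (auto intro!: mono_onI regulator_mono[OF w] simp: less_eq_vec_def y)
  have "0 \<le> y t" if "0 \<le> t" for t
    using regulator_ge(2)[OF w that order_refl] that by (simp add: less_eq_vec_def y)
  moreover have "0 \<le> ?z t" if "0 \<le> t" for t
    unfolding less_eq_vec_def
  proof
    fix i
    have "- ?w i t \<le> y t $ i"
      using regulator_ge(1)[OF w that order_refl, of i] by (simp only: y[OF that])
    then show "0 $ i \<le> ?z t $ i" unfolding reflection_component by simp
  qed
  moreover have "stieltjes ?z y = 0"
  proof (rule stieltjes_zero_if_locally_constant[OF cont_z mono_y])
    show "(y \<longlongrightarrow> y t) (at_right t)" if "0 \<le> t" for t
      using continuous_on_imp_cadlag[OF cont_y] that by (simp add: cadlag_def)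
    fix i s t assume st: "0 \<le> s" "s \<le> t" "\<And>r. s \<le> r \<Longrightarrow> r \<le> t \<Longrightarrow> 0 < ?z r $ i"
    show "y t $ i = y s $ i"
      using st(3) unfolding reflection_component y_def
      by (rule oblique_regulator_constant[OF x(1) st(1,2)])
  qed
  moreover have "y 0 = 0" unfolding y_def by (rule oblique_regulator_zero[OF x])
  ultimately show ?thesis
    using cont_y cont_z mono_y by (simp add: oblique_reflection_def continuous_on_imp_cadlag)
qed

text \<open>
  One contraction step for two solutions. Routing shrinks their difference $C u$ to $\rho C u$, so
  $y'_i(t) + \rho C u_i$ bounds the supremum which by minimality dominates $y_i(t)$.
\<close>
lemma oblique_reflection_step:
  assumes S: "oblique_reflection (mat 1 - P) x y z" and S': "oblique_reflection (mat 1 - P) x y' z'"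
    and t: "0 \<le> t" and "0 \<le> C"
    and close: "\<And>s j. 0 \<le> s \<Longrightarrow> s \<le> t \<Longrightarrow> \<bar>(y s - y' s) $ j\<bar> \<le> C * u $ j"
  shows "y t $ i \<le> y' t $ i + \<rho> * C * u $ i"
proof (rule complementary_path_minimal[where y = "\<lambda>s. y s $ i" and z = "\<lambda>s. z s $ i"])
  show "mono_on {0..} (\<lambda>t. y t $ i)" "y 0 $ i = 0"
    using S by (auto simp: oblique_reflection_def mono_on_def less_eq_vec_def)
  show "((\<lambda>t. y t $ i) \<longlongrightarrow> y s $ i) (at_right s)" if "0 \<le> s" for s
    using S that by (auto simp: oblique_reflection_def cadlag_def intro!: tendsto_vec_nth)
  show "(\<integral>\<^sup>+t\<in>{0..}. ennreal (z t $ i) \<partial>interval_measure (\<lambda>s. y (max s 0) $ i)) = 0"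
    using S by (auto simp: oblique_reflection_def stieltjes_def)
  have "0 \<le> y' t $ i" using S' t by (simp add: oblique_reflection_def less_eq_vec_def)
  then show "0 \<le> y' t $ i + \<rho> * C * u $ i"
    using rho(1) u_pos[of i] \<open>0 \<le> C\<close> by simp
  fix s assume s: "0 \<le> s" "s \<le> t"
  have "z s $ i = x s $ i - (P *v y s) $ i + y s $ i"
    using S s unfolding reflection_component[symmetric] by (simp add: oblique_reflection_def)
  moreover have "z' s $ i = x s $ i - (P *v y' s) $ i + y' s $ i"
    using S' s unfolding reflection_component[symmetric] by (simp add: oblique_reflection_def)
  moreover have "\<bar>(P *v (y s - y' s)) $ i\<bar> \<le> \<rho> * C * u $ i"
    using close[OF s] \<open>0 \<le> C\<close> by (rule P_contracts)
  moreover have "0 \<le> z' s $ i"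
  proof -
    have "0 \<le> z' s" using S' s unfolding oblique_reflection_def by blast
    then show ?thesis by (simp add: less_eq_vec_def)
  qed
  moreover have "y' s $ i \<le> y' t $ i"
    using S' s by (auto simp: oblique_reflection_def mono_on_def less_eq_vec_def)
  ultimately show "y s $ i - z s $ i \<le> y' t $ i + \<rho> * C * u $ i"
    by (simp add: matrix_vector_mult_diff_distrib)
qed (rule t)

lemma oblique_reflection_unique:
  assumes S: "oblique_reflection (mat 1 - P) x y z" and S': "oblique_reflection (mat 1 - P) x y' z'"
    and t: "0 \<le> t"
  shows "y t = y' t" and "z t = z' t"
proof -
  have nonneg: "0 \<le> y s $ j" "0 \<le> y' s $ j" if "0 \<le> s" for s j
    using S S' that by (auto simp: oblique_reflection_def less_eq_vec_def)
  have mono: "y s $ j \<le> y t $ j" "y' s $ j \<le> y' t $ j" if "0 \<le> s" "s \<le> t" for s j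
    using S S' that by (auto simp: oblique_reflection_def mono_on_def less_eq_vec_def)
  define K where "K = (\<Sum>j\<in>UNIV. (y t $ j + y' t $ j) / u $ j)"
  have K: "(y t $ j + y' t $ j) / u $ j \<le> K" for j
    unfolding K_def using nonneg[OF t] u_pos
    by (intro member_le_sum) (auto intro!: divide_nonneg_pos add_nonneg_nonneg)
  have K0: "0 \<le> K"
    unfolding K_def using nonneg[OF t] u_pos
    by (intro sum_nonneg divide_nonneg_pos add_nonneg_nonneg)
  have close: "\<bar>(y s - y' s) $ j\<bar> \<le> \<rho> ^ n * K * u $ j" if "0 \<le> s" "s \<le> t" for n s j
    using that
  proof (induction n arbitrary: s j)
    case 0
    have "y t $ j + y' t $ j \<le> K * u $ j"
      using K[of j] u_pos[of j] by (simp add: pos_divide_le_eq)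
    then show ?case using nonneg[OF 0(1), of j] mono[OF 0, of j] by (simp add: abs_le_iff)
  next
    case (Suc n)
    have C: "0 \<le> \<rho> ^ n * K" using rho(1) K0 by simp
    have "y s $ j \<le> y' s $ j + \<rho> * (\<rho> ^ n * K) * u $ j"
      using Suc by (intro oblique_reflection_step[OF S S'] C) auto
    moreover have "y' s $ j \<le> y s $ j + \<rho> * (\<rho> ^ n * K) * u $ j"
    proof (rule oblique_reflection_step[OF S' S _ C])
      fix r i assume "0 \<le> r" "r \<le> s"
      then show "\<bar>(y' r - y r) $ i\<bar> \<le> \<rho> ^ n * K * u $ i"
        using Suc.IH[of r i] Suc.prems by (simp add: abs_minus_commute)
    qed (rule Suc.prems)
    ultimately show ?case by (simp add: abs_le_iff ac_simps)
  qed
  show eq: "y t = y' t"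
    unfolding vec_eq_iff
  proof
    fix j
    have "(\<lambda>n. \<rho> ^ n * K * u $ j) \<longlonglongrightarrow> 0 * K * u $ j"
      using rho by (intro tendsto_intros LIMSEQ_realpow_zero) auto
    then have "\<bar>(y t - y' t) $ j\<bar> \<le> 0 * K * u $ j"
      by (rule LIMSEQ_le_const) (use close[OF t order_refl] in blast)
    then show "y t $ j = y' t $ j" by simp
  qed
  show "z t = z' t"
    using S S' t eq by (simp add: oblique_reflection_def)
qed

text \<open>
  The definite description selects the constructed solution, cut off at negative times.
\<close>
lemma reflection_pair_eq:
  assumes x: "continuous_on {0..} x" "0 \<le> x 0"
  shows "0 \<le> t \<Longrightarrow> refl_Phi (mat 1 - P) x t = oblique_regulator x t"
    and "0 \<le> t \<Longrightarrow> refl_Gamma (mat 1 - P) x t = x t + (mat 1 - P) *v oblique_regulator x t"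
    and "oblique_reflection (mat 1 - P) x (refl_Phi (mat 1 - P) x) (refl_Gamma (mat 1 - P) x)"
proof -
  let ?Y = "restrict (oblique_regulator x) {0..}"
  let ?Z = "restrict (\<lambda>t. x t + (mat 1 - P) *v oblique_regulator x t) {0..}"
  have YZ: "oblique_reflection (mat 1 - P) x ?Y ?Z"
    using oblique_regulator_reflects[OF x] by (subst oblique_reflection_cong) auto
  have "reflection_pair (mat 1 - P) x = (?Y, ?Z)"
    unfolding reflection_pair_def
  proof (rule the_equality)
    fix p assume "case p of (y, z) \<Rightarrow> y \<in> extensional {0..} \<and> z \<in> extensional {0..} \<and>
      oblique_reflection (mat 1 - P) x y z"
    moreover obtain y z where "p = (y, z)" by (cases p)
    ultimately show "p = (?Y, ?Z)"
      using oblique_reflection_unique[OF _ YZ, of y z]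
      by (auto intro!: extensionalityI[where A = "{0..}"])
  qed (use YZ in auto)
  then have eq: "refl_Phi (mat 1 - P) x = ?Y" "refl_Gamma (mat 1 - P) x = ?Z"
    by (simp_all add: refl_Phi_def refl_Gamma_def)
  show "refl_Phi (mat 1 - P) x t = oblique_regulator x t" if "0 \<le> t" using that eq by simp
  show "refl_Gamma (mat 1 - P) x t = x t + (mat 1 - P) *v oblique_regulator x t" if "0 \<le> t"
    using that eq by simp
  show "oblique_reflection (mat 1 - P) x (refl_Phi (mat 1 - P) x) (refl_Gamma (mat 1 - P) x)"
    unfolding eq by (rule YZ)
qed

end


section \<open>Directional derivatives along the drift\<close>

lemma mono_left_limit:
  fixes f :: "real \<Rightarrow> real"
  assumes f: "mono_on {0..} f" and "0 < t"
  shows "\<exists>l. (f \<longlongrightarrow> l) (at_left t)"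
proof -
  have "at_left t = at t within ({..<t} \<inter> {0..})"
    using \<open>0 < t\<close> by (intro at_within_nhd[of _ "{0<..}"]) auto
  moreover have "(f \<longlongrightarrow> Sup (f ` ({..<t} \<inter> {0..}))) (at t within ({..<t} \<inter> {0..}))"
    using \<open>0 < t\<close> by (intro Lim_left_bound[where K = "f t"]) (auto intro!: mono_onD[OF f])
  ultimately show ?thesis by auto
qed

text \<open>
  An infimum of continuous functions is upper semicontinuous; for a nondecreasing function this is
  right-continuity.
\<close>
lemma INF_mono_right_continuous:
  fixes g :: "'e \<Rightarrow> real \<Rightarrow> real"
  assumes "E \<noteq> {}" and cont: "\<And>e. e \<in> E \<Longrightarrow> continuous_on {0..} (g e)"
    and mono: "\<And>e. e \<in> E \<Longrightarrow> mono_on {0..} (g e)"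
    and nonneg: "\<And>e t. e \<in> E \<Longrightarrow> 0 \<le> t \<Longrightarrow> 0 \<le> g e t"
  shows "mono_on {0..} (\<lambda>t. INF e\<in>E. g e t)"
    and "0 \<le> t \<Longrightarrow> ((\<lambda>t. INF e\<in>E. g e t) \<longlongrightarrow> (INF e\<in>E. g e t)) (at_right t)"
proof -
  let ?f = "\<lambda>t. INF e\<in>E. g e t"
  have bdd: "bdd_below ((\<lambda>e. g e t) ` E)" if "0 \<le> t" for t
    using nonneg[OF _ that] by (intro bdd_belowI[of _ 0]) auto
  show f_mono: "mono_on {0..} ?f"
  proof (rule mono_onI)
    fix s t :: real assume st: "s \<in> {0..}" "t \<in> {0..}" "s \<le> t"
    show "?f s \<le> ?f t"
    proof (rule cINF_mono[OF \<open>E \<noteq> {}\<close> bdd])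
      fix e assume "e \<in> E"
      then show "\<exists>d\<in>E. g d s \<le> g e t" using mono_onD[OF mono st] by blast
    qed (use st in simp)
  qed
  assume t: "0 \<le> t"
  show "(?f \<longlongrightarrow> ?f t) (at_right t)"
  proof (rule order_tendstoI)
    fix a assume "a < ?f t"
    moreover have "?f t \<le> ?f s" if "t < s" for s
      using t that by (intro mono_onD[OF f_mono]) auto
    ultimately show "\<forall>\<^sub>F s in at_right t. a < ?f s"
      by (auto intro: less_le_trans eventually_mono[OF eventually_at_right_less])
  next
    fix a assume "?f t < a"
    then obtain e where e: "e \<in> E" "g e t < a"
      using cINF_less_iff[OF \<open>E \<noteq> {}\<close> bdd[OF t]] by blast
    have "(g e \<longlongrightarrow> g e t) (at_right t)"
      using continuous_on_imp_cadlag[OF cont[OF e(1)]] t by (simp add: cadlag_def)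
    then have "\<forall>\<^sub>F s in at_right t. g e s < a" using e(2) by (rule order_tendstoD)
    then show "\<forall>\<^sub>F s in at_right t. ?f s < a"
      using eventually_at_right_less[of t]
    proof eventually_elim
      case (elim s)
      have "?f s \<le> g e s" using elim t e(1) by (intro cINF_lower bdd) auto
      with elim show ?case by simp
    qed
  qed
qed

lemma cadlag_vecI:
  fixes f :: "real \<Rightarrow> 'a::topological_space ^ 'n"
  assumes "\<And>i. cadlag (\<lambda>t. f t $ i)"
  shows "cadlag f"
  unfolding cadlag_def
proof (intro conjI allI impI)
  show "(f \<longlongrightarrow> f t) (at_right t)" if "0 \<le> t" for t
    using assms that by (intro vec_tendstoI) (simp add: cadlag_def)
  fix t :: real assume "0 < t"
  then have "\<forall>i. \<exists>l. ((\<lambda>t. f t $ i) \<longlongrightarrow> l) (at_left t)"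
    using assms by (simp add: cadlag_def)
  then obtain l where "\<And>i. ((\<lambda>t. f t $ i) \<longlongrightarrow> l i) (at_left t)" by metis
  then have "(f \<longlongrightarrow> (\<chi> i. l i)) (at_left t)" by (intro vec_tendstoI) simp
  then show "\<exists>l. (f \<longlongrightarrow> l) (at_left t)" ..
qed

lemma cadlag_vec_nth:
  fixes f :: "real \<Rightarrow> 'a::topological_space ^ 'n"
  assumes "cadlag f"
  shows "cadlag (\<lambda>t. f t $ i)"
  unfolding cadlag_def
proof (intro conjI allI impI)
  show "((\<lambda>t. f t $ i) \<longlongrightarrow> f t $ i) (at_right t)" if "0 \<le> t" for t
    using assms that by (intro tendsto_vec_nth) (simp add: cadlag_def)
  fix t :: real assume "0 < t"
  then obtain l where "(f \<longlongrightarrow> l) (at_left t)" using assms unfolding cadlag_def by blast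
  then have "((\<lambda>t. f t $ i) \<longlongrightarrow> l $ i) (at_left t)" by (rule tendsto_vec_nth)
  then show "\<exists>l. ((\<lambda>t. f t $ i) \<longlongrightarrow> l) (at_left t)" ..
qed

lemma cadlag_diff_linear:
  fixes f g :: "real \<Rightarrow> 'a::real_normed_vector"
  assumes f: "cadlag f" and g: "cadlag g" and h: "bounded_linear h"
  shows "cadlag (\<lambda>t. f t - h (g t))"
  unfolding cadlag_def
proof (intro conjI allI impI)
  show "((\<lambda>t. f t - h (g t)) \<longlongrightarrow> f t - h (g t)) (at_right t)" if "0 \<le> t" for t
    using f g that by (auto simp: cadlag_def intro!: tendsto_diff bounded_linear.tendsto[OF h])
  fix t :: real assume "0 < t"
  obtain k where "(f \<longlongrightarrow> k) (at_left t)"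
    using f \<open>0 < t\<close> unfolding cadlag_def by blast
  moreover obtain l where "(g \<longlongrightarrow> l) (at_left t)"
    using g \<open>0 < t\<close> unfolding cadlag_def by blast
  ultimately have "((\<lambda>t. f t - h (g t)) \<longlongrightarrow> k - h l) (at_left t)"
    by (intro tendsto_diff bounded_linear.tendsto[OF h])
  then show "\<exists>l. ((\<lambda>t. f t - h (g t)) \<longlongrightarrow> l) (at_left t)" ..
qed

lemma bounded_linear_matrix_mult_left:
  fixes R :: "real^'n^'m"
  shows "bounded_linear (\<lambda>M :: real^'k^'n. R ** M)"
  unfolding linear_conv_bounded_linear[symmetric]
  by (rule linearI) (simp_all add: matrix_matrix_mult_def vec_eq_iff sum.distrib
      sum_distrib_left algebra_simps)

lemma column_drift_component: "column j (drift t) $ i = (if i = j then t else 0)"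
  by (simp add: drift_def column_def mat_def)

lemma column_drift_path:
  shows "continuous_on A (\<lambda>t. \<epsilon> *\<^sub>R column j (drift t :: real^'n^'n))"
    and "0 \<le> \<epsilon> \<Longrightarrow> mono_on A (\<lambda>t. \<epsilon> *\<^sub>R column j (drift t :: real^'n^'n))"
    and "column j (drift 0 :: real^'n^'n) = 0"
proof -
  have "(\<lambda>t. \<epsilon> *\<^sub>R column j (drift t :: real^'n^'n)) = (\<lambda>t. \<chi> i. \<epsilon> * (if i = j then t else 0))"
    by (auto simp: vec_eq_iff column_drift_component)
  moreover have "continuous_on A (\<lambda>t. (\<chi> i. \<epsilon> * (if i = j then t else 0)) :: real^'n)"
  proof (intro continuous_on_vec_lambda)
    show "continuous_on A (\<lambda>t. \<epsilon> * (if i = j then t else 0))" for i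
      by (cases "i = j") (auto intro!: continuous_intros)
  qed
  ultimately show "continuous_on A (\<lambda>t. \<epsilon> *\<^sub>R column j (drift t :: real^'n^'n))"
    by (simp only:)
  show "0 \<le> \<epsilon> \<Longrightarrow> mono_on A (\<lambda>t. \<epsilon> *\<^sub>R column j (drift t :: real^'n^'n))"
    by (auto simp: mono_on_def less_eq_vec_def column_drift_component mult_left_mono)
  show "column j (drift 0 :: real^'n^'n) = 0"
    by (simp add: vec_eq_iff column_drift_component)
qed

context contracting_matrix
begin

definition perturbed :: "(real \<Rightarrow> real^'n) \<Rightarrow> 'n \<Rightarrow> real \<Rightarrow> real \<Rightarrow> real^'n" where
  "perturbed x j \<epsilon> t = x t - \<epsilon> *\<^sub>R column j (drift t)"

text \<open>
  Difference quotient of the pushing path, with the sign of \<open>b\<close>: lowering the input increases the pushing.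
\<close>
definition slope :: "(real \<Rightarrow> real^'n) \<Rightarrow> 'n \<Rightarrow> real \<Rightarrow> real \<Rightarrow> real^'n" where
  "slope x j \<epsilon> t = (1 / \<epsilon>) *\<^sub>R (oblique_regulator (perturbed x j \<epsilon>) t - oblique_regulator x t)"

text \<open>
  The quotients decrease with \<open>\<epsilon>\<close>, so their limit at 0 can be written as an infimum; this form gives
  right-continuity.
\<close>
definition derivative :: "(real \<Rightarrow> real^'n) \<Rightarrow> 'n \<Rightarrow> real \<Rightarrow> real^'n" where
  "derivative x j t = (\<chi> i. INF \<epsilon>\<in>{0<..}. slope x j \<epsilon> t $ i)"

context
  fixes x :: "real \<Rightarrow> real^'n"
  assumes x: "continuous_on {0..} x" "0 \<le> x 0"
begin

lemma perturbed:
  "continuous_on {0..} (perturbed x j \<epsilon>)" "0 \<le> perturbed x j \<epsilon> 0"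
  unfolding perturbed_def using x column_drift_path(1)[of "{0..}" \<epsilon> j]
  by (auto simp: column_drift_path(3) intro!: continuous_intros)

lemma oblique_regulator_perturbed:
  assumes "0 < \<epsilon>"
  shows "oblique_regulator (perturbed x j \<epsilon>) t = oblique_regulator x t + \<epsilon> *\<^sub>R slope x j \<epsilon> t"
  using assms by (simp add: slope_def)

lemma slope_path:
  assumes "0 < \<epsilon>"
  shows "continuous_on {0..} (\<lambda>t. slope x j \<epsilon> t $ i)" "mono_on {0..} (\<lambda>t. slope x j \<epsilon> t $ i)"
    "slope x j \<epsilon> 0 = 0" "0 \<le> t \<Longrightarrow> 0 \<le> slope x j \<epsilon> t $ i"
proof -
  show "continuous_on {0..} (\<lambda>t. slope x j \<epsilon> t $ i)"
    unfolding slope_def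
    by (intro continuous_intros continuous_on_oblique_regulator x perturbed)
  have "mono_on {0..} (\<lambda>t. oblique_regulator (perturbed x j \<epsilon>) t $ i - oblique_regulator x t $ i)"
    unfolding perturbed_def
    by (rule oblique_regulator_comparison) (use x assms in \<open>auto intro: column_drift_path simp: column_drift_path\<close>)
  then show mono: "mono_on {0..} (\<lambda>t. slope x j \<epsilon> t $ i)"
    using assms by (auto simp: slope_def mono_on_def divide_right_mono)
  show zero: "slope x j \<epsilon> 0 = 0"
    by (simp add: slope_def oblique_regulator_zero x perturbed)
  show "0 \<le> slope x j \<epsilon> t $ i" if "0 \<le> t"
    using mono_onD[OF mono, of 0 t] that zero by simp
qed

text \<open>
  This is $z^\epsilon \le z$ divided by $\epsilon$.
\<close>
lemma slope_le_drift:
  assumes "0 < \<epsilon>" "0 \<le> t"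
  shows "slope x j \<epsilon> t $ i - (P *v slope x j \<epsilon> t) $ i \<le> column j (drift t) $ i"
proof -
  let ?y = "oblique_regulator x t" and ?y' = "oblique_regulator (perturbed x j \<epsilon>) t"
  have "?y' $ i - (P *v ?y') $ i \<le> ?y $ i - (P *v ?y) $ i + (\<epsilon> *\<^sub>R column j (drift t)) $ i"
    unfolding perturbed_def
    by (rule oblique_regulator_comparison(3))
      (use x assms in \<open>auto intro: column_drift_path simp: column_drift_path\<close>)
  then have "\<epsilon> * (slope x j \<epsilon> t $ i - (P *v slope x j \<epsilon> t) $ i) \<le> \<epsilon> * column j (drift t) $ i"
    unfolding oblique_regulator_perturbed[OF assms(1)]
    by (simp add: matrix_vector_right_distrib matrix_vector_mult_scaleR algebra_simps)
  then show ?thesis using assms(1) by simp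
qed

text \<open>
  Convexity in $\epsilon$: the perturbation of size $\epsilon$ is a convex combination of the one of size
  $\epsilon'$ and of \<open>x\<close> itself.
\<close>
lemma slope_mono:
  assumes "0 < \<epsilon>" "\<epsilon> \<le> \<epsilon>'" "0 \<le> t"
  shows "slope x j \<epsilon> t $ i \<le> slope x j \<epsilon>' t $ i"
proof -
  let ?y = "oblique_regulator x t"
  have "oblique_regulator (perturbed x j \<epsilon>) t $ i
      \<le> (\<epsilon> / \<epsilon>') * oblique_regulator (perturbed x j \<epsilon>') t $ i + (1 - \<epsilon> / \<epsilon>') * ?y $ i"
    using assms
    by (intro oblique_regulator_sublinear perturbed x) (auto simp: perturbed_def field_simps)
  also have "\<dots> = ?y $ i + \<epsilon> * slope x j \<epsilon>' t $ i"
    using assms by (simp add: oblique_regulator_perturbed field_simps)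
  finally show ?thesis
    using assms by (simp add: oblique_regulator_perturbed)
qed

lemma slope_tendsto:
  assumes t: "0 \<le> t"
  shows "((\<lambda>\<epsilon>. slope x j \<epsilon> t $ i) \<longlongrightarrow> derivative x j t $ i) (at_right 0)"
  using Lim_right_bound[of UNIV 0 "\<lambda>\<epsilon>. slope x j \<epsilon> t $ i" 0] t
  by (simp add: derivative_def slope_mono slope_path)

lemma derivative_path:
  shows "mono_on {0..} (derivative x j)" "derivative x j 0 = 0"
    "cadlag (derivative x j)"
proof -
  have mono: "mono_on {0..} (\<lambda>t. derivative x j t $ i)"
    and rc: "0 \<le> t \<Longrightarrow> ((\<lambda>t. derivative x j t $ i) \<longlongrightarrow> derivative x j t $ i) (at_right t)" for i t
    unfolding derivative_def vec_lambda_beta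
    by (rule INF_mono_right_continuous; auto intro: slope_path)+
  from mono show "mono_on {0..} (derivative x j)"
    by (auto simp: mono_on_def less_eq_vec_def)
  show "cadlag (derivative x j)"
    using rc mono_left_limit[OF mono] by (intro cadlag_vecI) (simp add: cadlag_def)
  show "derivative x j 0 = 0"
    by (simp add: derivative_def vec_eq_iff slope_path)
qed

lemma derivative_le_drift:
  assumes t: "0 \<le> t"
  shows "derivative x j t $ i - (P *v derivative x j t) $ i \<le> column j (drift t) $ i"
proof (rule tendsto_upperbound)
  show "((\<lambda>\<epsilon>. slope x j \<epsilon> t $ i - (P *v slope x j \<epsilon> t) $ i)
      \<longlongrightarrow> derivative x j t $ i - (P *v derivative x j t) $ i) (at_right 0)"
    unfolding matrix_vector_mult_def vec_lambda_beta by (intro tendsto_intros slope_tendsto t)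
  show "\<forall>\<^sub>F \<epsilon> in at_right 0. slope x j \<epsilon> t $ i - (P *v slope x j \<epsilon> t) $ i \<le> column j (drift t) $ i"
    using slope_le_drift t by (auto intro: eventually_mono[OF eventually_at_right_less])
qed simp

text \<open>
  The perturbed reflected path $z^\epsilon \ge 0$, expanded around \<open>z\<close>.
\<close>
lemma perturbed_slack_nonneg:
  assumes "0 < \<epsilon>" "0 \<le> t"
  shows "0 \<le> (x t + (mat 1 - P) *v oblique_regulator x t) $ i
    + \<epsilon> * (slope x j \<epsilon> t $ i - (P *v slope x j \<epsilon> t) $ i - column j (drift t) $ i)"
proof -
  let ?y' = "oblique_regulator (perturbed x j \<epsilon>)"
  have "?y' t $ i = regulator (\<lambda>s. perturbed x j \<epsilon> s $ i - (P *v ?y' s) $ i) t"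
    by (rule oblique_regulator_fixpoint[OF perturbed(1) assms(2)])
  also have "\<dots> \<ge> - (perturbed x j \<epsilon> t $ i - (P *v ?y' t) $ i)"
    by (intro regulator_ge continuous_on_oblique_slack perturbed assms order_refl)
  finally show ?thesis
    unfolding reflection_component oblique_regulator_perturbed[OF assms(1)]
    by (simp add: perturbed_def matrix_vector_right_distrib matrix_vector_mult_scaleR algebra_simps)
qed

lemma derivative_ge_drift:
  assumes t: "0 \<le> t" and "(x t + (mat 1 - P) *v oblique_regulator x t) $ i = 0"
  shows "column j (drift t) $ i \<le> derivative x j t $ i - (P *v derivative x j t) $ i"
proof (rule tendsto_lowerbound)
  show "((\<lambda>\<epsilon>. slope x j \<epsilon> t $ i - (P *v slope x j \<epsilon> t) $ i)
      \<longlongrightarrow> derivative x j t $ i - (P *v derivative x j t) $ i) (at_right 0)"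
    unfolding matrix_vector_mult_def vec_lambda_beta by (intro tendsto_intros slope_tendsto t)
  show "\<forall>\<^sub>F \<epsilon> in at_right 0. column j (drift t) $ i \<le> slope x j \<epsilon> t $ i - (P *v slope x j \<epsilon> t) $ i"
    using eventually_at_right_less[of 0]
  proof eventually_elim
    case (elim \<epsilon>)
    then show ?case
      using perturbed_slack_nonneg[OF elim t, of i j] assms(2) by (simp add: zero_le_mult_iff)
  qed
qed simp

text \<open>
  On $[s,t]$ the path $z_i$ has a positive minimum, and $z_i - z^\epsilon_i \le \epsilon C$ with \<open>C\<close>
  independent of time and of $\epsilon \le 1$. So $z^\epsilon_i > 0$ for small $\epsilon$, and neither pushing
  path moves in direction \<open>i\<close>.
\<close>
lemma derivative_constant:
  assumes st: "0 \<le> s" "s \<le> t"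
    and pos: "\<And>r. s \<le> r \<Longrightarrow> r \<le> t \<Longrightarrow> 0 < (x r + (mat 1 - P) *v oblique_regulator x r) $ i"
  shows "derivative x j t $ i = derivative x j s $ i"
proof -
  let ?y = "oblique_regulator x"
  let ?z = "\<lambda>r. (x r + (mat 1 - P) *v ?y r) $ i"
  have "continuous_on {0..} ?z"
    unfolding reflection_component
    by (intro continuous_intros continuous_on_oblique_slack continuous_on_oblique_regulator x)
  then have "continuous_on {s..t} ?z" by (rule continuous_on_subset) (use st in auto)
  then obtain r0 where r0: "r0 \<in> {s..t}" "\<And>r. r \<in> {s..t} \<Longrightarrow> ?z r0 \<le> ?z r"
    using continuous_attains_inf[of "{s..t}" ?z] st(2) by auto
  \<comment> \<open>Slopes grow in time and in \<open>\<epsilon>\<close>, so those at time \<open>t\<close> for \<open>\<epsilon> = 1\<close> dominate all the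
    relevant ones; the summand 1 keeps \<open>C\<close> positive.\<close>
  define C where "C = column j (drift t) $ i + (P *v slope x j 1 t) $ i + 1"
  have drift_mono: "0 \<le> column j (drift r) $ i" "column j (drift r) $ i \<le> column j (drift t) $ i"
    if "0 \<le> r" "r \<le> t" for r
    using that by (simp_all add: column_drift_component)
  have "0 \<le> (P *v slope x j 1 t) $ i"
    using P_mono[of 0 "slope x j 1 t" i] slope_path(4)[of 1 t j] st by simp
  then have "0 < C" using drift_mono[of t] st by (simp add: C_def)
  have "slope x j \<epsilon> t $ i = slope x j \<epsilon> s $ i"
    if \<epsilon>: "0 < \<epsilon>" "\<epsilon> < min 1 (?z r0 / C)" for \<epsilon>
  proof -
    let ?y' = "oblique_regulator (perturbed x j \<epsilon>)"
    have "?y' t $ i = ?y' s $ i"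
    proof (rule oblique_regulator_constant[OF perturbed(1) st])
      fix r assume r: "s \<le> r" "r \<le> t"
      have "0 \<le> r" using r st by simp
      have "slope x j \<epsilon> r $ k \<le> slope x j 1 t $ k" for k
      proof -
        have "slope x j \<epsilon> r $ k \<le> slope x j \<epsilon> t $ k"
          using r \<open>0 \<le> r\<close> by (intro mono_onD[OF slope_path(2)] \<epsilon>) auto
        also have "\<dots> \<le> slope x j 1 t $ k"
          using \<epsilon> st by (intro slope_mono) auto
        finally show ?thesis .
      qed
      then have "(P *v slope x j \<epsilon> r) $ i \<le> (P *v slope x j 1 t) $ i" by (rule P_mono)
      then have "column j (drift r) $ i - slope x j \<epsilon> r $ i + (P *v slope x j \<epsilon> r) $ i \<le> C"
        using drift_mono[OF \<open>0 \<le> r\<close> r(2)] slope_path(4)[OF \<epsilon>(1) \<open>0 \<le> r\<close>, of j i] by (simp add: C_def)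
      then have "\<epsilon> * (column j (drift r) $ i - slope x j \<epsilon> r $ i + (P *v slope x j \<epsilon> r) $ i) \<le> \<epsilon> * C"
        using \<epsilon>(1) by (intro mult_left_mono) auto
      also have "\<dots> < ?z r0" using \<epsilon>(2) \<open>0 < C\<close> by (simp add: pos_less_divide_eq)
      also have "\<dots> \<le> ?z r" using r by (intro r0) auto
      finally show "0 < perturbed x j \<epsilon> r $ i - (P *v ?y' r) $ i + ?y' r $ i"
        unfolding reflection_component oblique_regulator_perturbed[OF \<epsilon>(1)]
        by (simp add: perturbed_def matrix_vector_right_distrib matrix_vector_mult_scaleR algebra_simps)
    qed
    moreover have "?y t $ i = ?y s $ i"
      using pos unfolding reflection_component
      by (rule oblique_regulator_constant[OF x(1) st])
    ultimately show ?thesis by (simp add: slope_def)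
  qed
  moreover have "0 < min 1 (?z r0 / C)" using pos[of r0] r0(1) \<open>0 < C\<close> by simp
  ultimately have "\<forall>\<^sub>F \<epsilon> in at_right 0. slope x j \<epsilon> t $ i = slope x j \<epsilon> s $ i"
    by (intro eventually_mono[OF eventually_at_right_real[of 0 "min 1 (?z r0 / C)"]]) auto
  then have "((\<lambda>\<epsilon>. slope x j \<epsilon> s $ i) \<longlongrightarrow> derivative x j t $ i) (at_right 0)"
    using slope_tendsto[of t j i] st by (simp add: tendsto_cong)
  with slope_tendsto[OF st(1)] show ?thesis
    by (intro tendsto_unique[of "at_right 0"]) auto
qed

definition jacobian :: "real \<Rightarrow> real^'n^'n" where
  "jacobian t = (\<chi> i j. derivative x j t $ i)"

lemma column_jacobian: "column j (jacobian t) = derivative x j t"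
  by (simp add: column_def jacobian_def vec_eq_iff)

lemma cadlag_jacobian: "cadlag jacobian"
  unfolding jacobian_def
  by (intro cadlag_vecI) (simp add: cadlag_vec_nth derivative_path)

lemma matrix_jacobian_component:
  "(drift t - (mat 1 - P) ** jacobian t) $ i $ j
    = column j (drift t) $ i - (derivative x j t $ i - (P *v derivative x j t) $ i)"
proof -
  have "((mat 1 - P) ** jacobian t) $ i $ j = ((mat 1 - P) *v derivative x j t) $ i"
    by (simp add: matrix_matrix_mult_def matrix_vector_mult_def jacobian_def)
  also have "\<dots> = derivative x j t $ i - (P *v derivative x j t) $ i"
    by (simp add: matrix_vector_mult_diff_rdistrib)
  finally show ?thesis by (simp add: column_def)
qed

lemma path_deriv_reflection:
  assumes t: "0 \<le> t"
  shows "path_deriv (refl_Phi (mat 1 - P)) x t = - jacobian t"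
    and "path_deriv (refl_Gamma (mat 1 - P)) x t = drift t - (mat 1 - P) ** jacobian t"
proof -
  have Phi: "((1 / \<epsilon>) *\<^sub>R (refl_Phi (mat 1 - P) x t
      - refl_Phi (mat 1 - P) (\<lambda>s. x s - \<epsilon> *\<^sub>R column j (drift s)) t)) $ i = - slope x j \<epsilon> t $ i"
    if "0 < \<epsilon>" for \<epsilon> i j
    unfolding perturbed_def[symmetric, abs_def] reflection_pair_eq(1)[OF x t]
      reflection_pair_eq(1)[OF perturbed t]
    using that by (simp add: oblique_regulator_perturbed)
  have Gamma: "((1 / \<epsilon>) *\<^sub>R (refl_Gamma (mat 1 - P) x t
      - refl_Gamma (mat 1 - P) (\<lambda>s. x s - \<epsilon> *\<^sub>R column j (drift s)) t)) $ i
      = column j (drift t) $ i - (slope x j \<epsilon> t $ i - (P *v slope x j \<epsilon> t) $ i)"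
    if "0 < \<epsilon>" for \<epsilon> i j
    unfolding perturbed_def[symmetric, abs_def] reflection_pair_eq(2)[OF x t]
      reflection_pair_eq(2)[OF perturbed t] vector_scaleR_component vector_minus_component
      reflection_component oblique_regulator_perturbed[OF that]
    using that by (simp add: perturbed_def matrix_vector_right_distrib matrix_vector_mult_scaleR field_simps)
  have pos: "\<forall>\<^sub>F \<epsilon> in at_right (0::real). 0 < \<epsilon>" by (rule eventually_at_right_less)
  show "path_deriv (refl_Phi (mat 1 - P)) x t = - jacobian t"
    unfolding path_deriv_def
  proof (intro tendsto_Lim vec_tendstoI)
    fix i j
    have "((\<lambda>\<epsilon>. - slope x j \<epsilon> t $ i) \<longlongrightarrow> - derivative x j t $ i) (at_right 0)"
      by (intro tendsto_intros slope_tendsto t)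
    then have "((\<lambda>\<epsilon>. - slope x j \<epsilon> t $ i) \<longlongrightarrow> (- jacobian t) $ i $ j) (at_right 0)"
      by (simp add: jacobian_def)
    then show "((\<lambda>\<epsilon>. (\<chi> i j. ((1 / \<epsilon>) *\<^sub>R (refl_Phi (mat 1 - P) x t
      - refl_Phi (mat 1 - P) (\<lambda>s. x s - \<epsilon> *\<^sub>R column j (drift s)) t)) $ i) $ i $ j)
        \<longlongrightarrow> (- jacobian t) $ i $ j) (at_right 0)"
      by (rule Lim_transform_eventually)
        (use pos in \<open>auto elim!: eventually_mono simp only: vec_lambda_beta Phi\<close>)
  qed simp
  show "path_deriv (refl_Gamma (mat 1 - P)) x t = drift t - (mat 1 - P) ** jacobian t"
    unfolding path_deriv_def
  proof (intro tendsto_Lim vec_tendstoI)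
    fix i j
    have "((\<lambda>\<epsilon>. column j (drift t) $ i - (slope x j \<epsilon> t $ i - (P *v slope x j \<epsilon> t) $ i))
      \<longlongrightarrow> (drift t - (mat 1 - P) ** jacobian t) $ i $ j) (at_right 0)"
      unfolding matrix_jacobian_component matrix_vector_mult_def vec_lambda_beta
      by (intro tendsto_intros slope_tendsto t)
    then show "((\<lambda>\<epsilon>. (\<chi> i j. ((1 / \<epsilon>) *\<^sub>R (refl_Gamma (mat 1 - P) x t
      - refl_Gamma (mat 1 - P) (\<lambda>s. x s - \<epsilon> *\<^sub>R column j (drift s)) t)) $ i) $ i $ j)
        \<longlongrightarrow> (drift t - (mat 1 - P) ** jacobian t) $ i $ j) (at_right 0)"
      by (rule Lim_transform_eventually)
        (use pos in \<open>auto elim!: eventually_mono simp only: vec_lambda_beta Gamma\<close>)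
  qed simp
qed

end

end


section \<open>The augmented Skorohod problem\<close>

theorem theorem2:
  fixes R :: "real^'n^'n"
    and x z y :: "real \<Rightarrow> real^'n"
    and a b :: "real \<Rightarrow> real^'n^'n"
  assumes "reflection_matrix R"
    and "continuous_on {0..} x"
    and "0 \<le> x 0"
    and "z = refl_Gamma R x"
    and "y = refl_Phi R x"
    and "a = path_deriv (refl_Gamma R) x"
    and "b = (\<lambda>t. - path_deriv (refl_Phi R) x t)"
  shows "augmented_skorohod R R x drift z y a b"
proof -
  obtain P where P: "R = mat 1 - P" "0 \<le> P" "matrix_spectral_radius P < 1"
    using assms(1) by (auto simp: reflection_matrix_def)
  have P_nonneg: "0 \<le> P $ i $ j" for i j using P(2) by (simp add: less_eq_vec_def)
  obtain u \<rho> where "contracting_matrix P u \<rho>"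
    using positive_vector_contracted[OF P_nonneg P(3)] P_nonneg
    by (metis contracting_matrix.intro)
  then interpret contracting_matrix P u \<rho> .
  note x = assms(2,3)
  let ?y = "oblique_regulator x" and ?z = "\<lambda>t. x t + R *v oblique_regulator x t"
  have y: "y t = ?y t" and z: "z t = ?z t" if "0 \<le> t" for t
    using that reflection_pair_eq(1,2)[OF x] by (simp_all add: assms P(1))
  have S: "oblique_reflection R x y z"
    using reflection_pair_eq(3)[OF x] by (simp add: assms P(1))
  have b: "b t = jacobian x t" and a: "a t = drift t - R ** jacobian x t" if "0 \<le> t" for t
    using that path_deriv_reflection[OF x] by (simp_all add: assms P(1))
  have cont_y: "continuous_on {0..} y"
    by (rule continuous_on_eq[OF continuous_on_oblique_regulator[OF x(1)]]) (simp add: y)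
  have cont_z: "continuous_on {0..} z"
  proof -
    have "continuous_on {0..} ?z"
      by (intro continuous_intros x continuous_on_oblique_regulator
          bounded_linear.continuous_on[OF matrix_vector_mul_bounded_linear])
    then show ?thesis by (rule continuous_on_eq) (simp add: z)
  qed
  have drift: "continuous_on {0..} (drift :: real \<Rightarrow> real^'n^'n)"
    "mono_on {0..} (drift :: real \<Rightarrow> real^'n^'n)"
    "0 \<le> t \<Longrightarrow> 0 \<le> (drift t :: real^'n^'n)" for t
    by (auto simp: drift_def mono_on_def less_eq_vec_def mat_def intro!: continuous_intros)
  have mono_d: "derivative x j s $ i \<le> derivative x j t $ i" if "0 \<le> s" "s \<le> t" for s t i j
    using derivative_path(1)[OF x, of j] that by (auto simp: mono_on_def less_eq_vec_def)
  have jac_nonneg: "0 \<le> jacobian x t" if "0 \<le> t" for t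
    using mono_d[OF order_refl that] derivative_path(2)[OF x]
    by (simp add: jacobian_def[OF x] less_eq_vec_def)
  have jac_mono: "mono_on {0..} (jacobian x)"
    using mono_d by (auto simp: mono_on_def less_eq_vec_def jacobian_def[OF x])
  note jac_cadlag = cadlag_jacobian[OF x]
  have cadlag_b: "cadlag b" using cadlag_cong[OF b] jac_cadlag by simp
  have "cadlag (\<lambda>t. drift t - R ** jacobian x t)"
    by (intro cadlag_diff_linear jac_cadlag bounded_linear_matrix_mult_left
        continuous_on_imp_cadlag drift)
  then have cadlag_a: "cadlag a" using cadlag_cong[OF a] by simp
  have a_component: "a t $ i $ j
      = column j (drift t) $ i - (derivative x j t $ i - (P *v derivative x j t) $ i)"
    if "0 \<le> t" for t i j
    using a[OF that] matrix_jacobian_component[OF x] by (simp add: P(1))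
  have a_nonneg: "0 \<le> a t" if "0 \<le> t" for t
    using derivative_le_drift[OF x that] by (simp add: less_eq_vec_def a_component[OF that])
  \<comment> \<open>On the face \<open>z_i = 0\<close> the upper and the lower estimate of the derivative coincide.\<close>
  have boundary: "a t $ i = 0" if "0 \<le> t" "z t $ i = 0" for t i
    using derivative_ge_drift[OF x that(1), of i] derivative_le_drift[OF x that(1), of _ i] that(2) z[OF that(1)]
    by (auto simp: vec_eq_iff a_component[OF that(1)] P(1) intro!: antisym)
  have compl: "stieltjes z (\<lambda>t. column j (b t)) = 0" for j
  proof (rule stieltjes_zero_if_locally_constant[OF cont_z])
    have col: "column j (b t) = derivative x j t" if "0 \<le> t" for t
      using b[OF that] by (simp add: column_jacobian[OF x])
    show "mono_on {0..} (\<lambda>t. column j (b t))"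
      using derivative_path(1)[OF x] by (auto simp: mono_on_def col)
    have "cadlag (\<lambda>t. column j (b t))"
      using cadlag_cong[OF col] derivative_path(3)[OF x] by simp
    then show "((\<lambda>t. column j (b t)) \<longlongrightarrow> column j (b t)) (at_right t)" if "0 \<le> t" for t
      using that by (simp add: cadlag_def)
    fix i s t assume st: "0 \<le> s" "s \<le> t" "\<And>r. s \<le> r \<Longrightarrow> r \<le> t \<Longrightarrow> 0 < z r $ i"
    then show "column j (b t) $ i = column j (b s) $ i"
      using derivative_constant[OF x st(1,2), of i j] by (simp add: col z P(1))
  qed
  have "b 0 = 0"
    using derivative_path(2)[OF x] by (simp add: b jacobian_def[OF x] vec_eq_iff)
  moreover have "mono_on {0..} b" using jac_mono b by (auto simp: mono_on_def)
  ultimately show ?thesis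
    unfolding augmented_skorohod_def
    using S assms(1,2) drift cont_y cont_z cadlag_a cadlag_b a_nonneg jac_nonneg a b boundary compl
    by (auto simp: oblique_reflection_def)
qed

end
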